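(* Let $\{S^n\}_{n\in\mathbb{N}}$ be an $\mathbb{R}^h$-valued process that is exponentially regular and exponentially nearly additive, and suppose $\sup_{n\in\mathbb{N}}|\Lambda^n|^{-1}\log\mathbb{E}[\exp(\langle\lambda,S^n\rangle)]<\infty$ for every $\lambda\in\mathbb{R}^h$. Then the limit $\widehat S=\lim_{n\to\infty}\mathbb{E}[S^n]/|\Lambda^n|$ exists in $\mathbb{R}^h$; for every $\lambda\in\mathbb{R}^h$ the limit $\varphi(\lambda)=\lim_{n\to\infty}|\Lambda^n|^{-1}\log\mathbb{E}[\exp(\langle\lambda,S^n\rangle)]$ exists in $\mathbb{R}$; the process $\{S^n/|\Lambda^n|\}_{n\in\mathbb{N}}$ satisfies the LDP with speed $|\Lambda^n|$ and good convex rate function $\varphi^*$; and $\varphi^*(x)=0$ if and only if $x=\widehat S$.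
   Context: Fix $d,h\in\mathbb{N}$, $|\Lambda^n|:=(2n)^d$, $\langle\cdot,\cdot\rangle$ and $\|\cdot\|$ the Euclidean inner product and norm on $\mathbb{R}^h$. Exponentially $r$-nearly additive (integer $r\ge0$): there exist $\mathbb{R}^h$-valued random variables $\{S^{n,z}\}_{n\in\mathbb{N},z\in\mathbb{Z}^d}$ such that for each $n$, $\{S^{n,z}\}_{z\in\mathbb{Z}^d}$ are independent copies of $S^n$, and for all $\varepsilon>0$, $C>0$ there is an integer $K>r$ with $P\bigl(\|S^{(2m+1)k}-\sum_{z\in\mathbb{Z}^d\cap[-m,m]^d}S^{k-r,z}\|>\varepsilon|\Lambda^{(2m+1)k}|\bigr)\le\exp(-C|\Lambda^{(2m+1)k}|)$ for all $k\ge K$, $m\in\mathbb{N}$. Exponentially nearly additive: exponentially $r$-nearly additive for some $r$. Exponentially regular: for each fixed $k\in\mathbb{N}$, letting $m_n$ be the unique integer with $(2m_n+1)k\le n<(2m_n+3)k$ (for $n\ge k$), for every $\varepsilon,C>0$ there is $N$ with $P(\|S^n-S^{(2m_n+1)k}\|>\varepsilon|\Lambda^n|)\le\exp(-C|\Lambda^n|)$ for all $n\ge N$. Fenchel–Legendre transform $\varphi^*(x)=\sup_{\lambda\in\mathbb{R}^h}\{\langle\lambda,x\rangle-\varphi(\lambda)\}$. LDP with speed $a_n$ and (good) rate function as standard. *)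

theory Defs
  imports "HOL-Probability.Probability"
begin

definition boxvol :: "nat \<Rightarrow> nat \<Rightarrow> real" where
  "boxvol d n = (2 * real n) ^ d"

definition cube :: "nat \<Rightarrow> nat \<Rightarrow> int list set" where
  "cube d m = {z. length z = d \<and> (\<forall>i<d. - int m \<le> z ! i \<and> z ! i \<le> int m)}"

definition elog :: "real \<Rightarrow> ereal" where
  "elog p = (if p = 0 then - \<infinity> else ereal (ln p))"

definition exp_r_nearly_additive ::
  "'a measure \<Rightarrow> nat \<Rightarrow> (nat \<Rightarrow> 'a \<Rightarrow> 'v::euclidean_space) \<Rightarrow> nat \<Rightarrow> bool" where
  "exp_r_nearly_additive M d S r \<longleftrightarrow>
     (\<exists>S' :: nat \<Rightarrow> int list \<Rightarrow> 'a \<Rightarrow> 'v.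
        (\<forall>n\<ge>1. (\<forall>z. S' n z \<in> borel_measurable M)
              \<and> prob_space.indep_vars M (\<lambda>_. borel) (S' n) {z. length z = d}
              \<and> (\<forall>z. length z = d \<longrightarrow> distr M borel (S' n z) = distr M borel (S n)))
      \<and> (\<forall>\<epsilon>>0. \<forall>C>0. \<exists>K::nat. K > r \<and> (\<forall>k\<ge>K. \<forall>m\<ge>1.
           measure M {\<omega> \<in> space M.
              norm (S ((2*m+1)*k) \<omega> - (\<Sum>z\<in>cube d m. S' (k - r) z \<omega>))
                > \<epsilon> * boxvol d ((2*m+1)*k)}
           \<le> exp (- C * boxvol d ((2*m+1)*k)))))"

definition exp_nearly_additive ::
  "'a measure \<Rightarrow> nat \<Rightarrow> (nat \<Rightarrow> 'a \<Rightarrow> 'v::euclidean_space) \<Rightarrow> bool" where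
  "exp_nearly_additive M d S \<longleftrightarrow> (\<exists>r. exp_r_nearly_additive M d S r)"

definition mblock :: "nat \<Rightarrow> nat \<Rightarrow> nat" where
  "mblock k n = (THE m. (2*m+1)*k \<le> n \<and> n < (2*m+3)*k)"

definition exp_regular ::
  "'a measure \<Rightarrow> nat \<Rightarrow> (nat \<Rightarrow> 'a \<Rightarrow> 'v::euclidean_space) \<Rightarrow> bool" where
  "exp_regular M d S \<longleftrightarrow>
     (\<forall>k\<ge>1. \<forall>\<epsilon>>0. \<forall>C>0. \<exists>N. \<forall>n\<ge>N. k \<le> n \<longrightarrow>
        measure M {\<omega> \<in> space M.
           norm (S n \<omega> - S ((2 * mblock k n + 1) * k) \<omega>) > \<epsilon> * boxvol d n}
        \<le> exp (- C * boxvol d n))"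

definition fenchel :: "('v::real_inner \<Rightarrow> real) \<Rightarrow> 'v \<Rightarrow> ereal" where
  "fenchel \<phi> x = (SUP l. ereal (l \<bullet> x - \<phi> l))"

definition rate_function :: "('v::topological_space \<Rightarrow> ereal) \<Rightarrow> bool" where
  "rate_function I \<longleftrightarrow> (\<forall>x. 0 \<le> I x) \<and> (\<forall>c::real. closed {x. I x \<le> ereal c})"

definition good_rate_function :: "('v::topological_space \<Rightarrow> ereal) \<Rightarrow> bool" where
  "good_rate_function I \<longleftrightarrow> rate_function I \<and> (\<forall>c::real. compact {x. I x \<le> ereal c})"

definition convex_efun :: "('v::real_vector \<Rightarrow> ereal) \<Rightarrow> bool" where
  "convex_efun I \<longleftrightarrow> (\<forall>x y. \<forall>t::real. 0 < t \<and> t < 1 \<longrightarrow>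
      I (t *\<^sub>R x + (1 - t) *\<^sub>R y) \<le> ereal t * I x + ereal (1 - t) * I y)"

definition LDP ::
  "'a measure \<Rightarrow> (nat \<Rightarrow> 'a \<Rightarrow> 'v::topological_space) \<Rightarrow> (nat \<Rightarrow> real) \<Rightarrow> ('v \<Rightarrow> ereal) \<Rightarrow> bool" where
  "LDP M Y a I \<longleftrightarrow> (\<forall>\<Gamma> \<in> sets borel.
      - (INF x\<in>interior \<Gamma>. I x)
        \<le> liminf (\<lambda>n. ereal (1 / a n) * elog (measure M {\<omega> \<in> space M. Y n \<omega> \<in> \<Gamma>}))
    \<and> limsup (\<lambda>n. ereal (1 / a n) * elog (measure M {\<omega> \<in> space M. Y n \<omega> \<in> \<Gamma>}))
        \<le> - (INF x\<in>closure \<Gamma>. I x))"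

end

theory Submission
  imports Defs
begin

text \<open>
  Write \<open>v n\<close> for the box volume. Outside an event of negligible probability \<open>S n\<close> is within \<open>e * v n\<close>
  of a sum of \<open>(2 m + 1)\<^sup>d\<close> independent copies of \<open>S (k - r)\<close>, whose scaled logarithmic moment generating
  function is, asymptotically, \<open>c k l = ln (mgf (S (k - r)) l) / v k\<close>. Since all exponential moments are
  controlled, replacing \<open>S n\<close> by this sum changes the scaled logarithm of the moment generating function
  at \<open>l\<close> by at most \<open>e * norm l + ln 2 / v n\<close>. Hence the limit \<open>\<phi>\<close> exists and \<open>\<bar>\<phi> l - c k l\<bar> \<le> e * norm l\<close>
  on bounded sets for large \<open>k\<close>. The factor \<open>norm l\<close> makes \<open>\<phi>\<close> differentiable at \<open>0\<close>, and its gradient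
  there, the limit of the scaled means, is the only zero of the Fenchel transform.

  The upper large deviation bound is the Chernoff bound with a compactness argument. As \<open>\<phi>\<close> need not be
  differentiable away from \<open>0\<close>, the lower bound at \<open>x\<close> is proved for the smooth approximation \<open>c k\<close>, by
  exponential tilting at a maximiser of \<open>l \<bullet> x - c k l - \<theta> * (norm l)\<^sup>2\<close>, and transferred to \<open>S n\<close>.
\<close>

section \<open>Moment generating functions\<close>

text \<open>A limit of smooth functions need not be smooth. What rescues the point 0 is that the
  error is relative: on the good event Cauchy-Schwarz bounds \<open>l \<bullet> (S n - Y n)\<close>
  by \<open>norm l * e * v n\<close>, which vanishes with \<open>l\<close>, while the
  \<open>ln 2\<close> left by the bad event disappears after division by \<open>v n\<close>. Away
  from 0 the estimate does not shrink relative to increments of \<open>l\<close>, so it says nothing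
  about gradients there. A small probability alone does not make the bad event harmless, since
  \<open>exp (l \<bullet> S n)\<close> may be exponentially large on it. This is why
  \<open>C\<close> must be arbitrary: it is chosen after the growth rate \<open>b\<close> of the
  moment generating functions. No derivative is taken. One-sided bounds suffice:
  \<open>1 + z \<le> exp z\<close> yields supporting hyperplanes from below, and a quadratic upper
  bound, whose linear term is the mean under the tilted measure, identifies gradients and yields
  concentration. \<open>c k\<close> is normalised by \<open>v k\<close> although it is built from
  \<open>S (k - r)\<close>, so that the block sum has logarithmic moment generating function exactly
  \<open>w n * c k l\<close>.\<close>

text \<open>Reduces the norm to a single coordinate, so that norm moments and tails outside a ball
  are controlled by finitely many exponentials of linear functionals.\<close>

lemma ex_Basis_norm_le:
  fixes z :: "'v::euclidean_space"
  shows "\<exists>b\<in>Basis. norm z \<le> real DIM('v) * \<bar>b \<bullet> z\<bar>"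
proof (rule ccontr)
  assume "\<not> ?thesis"
  then have lt: "\<bar>b \<bullet> z\<bar> < norm z / real DIM('v)" if "b \<in> Basis" for b :: 'v
    using that by (auto simp: field_simps not_le)
  have "norm z \<le> (\<Sum>b\<in>Basis. \<bar>z \<bullet> b\<bar>)" by (rule norm_le_l1)
  also have "\<dots> < (\<Sum>b\<in>(Basis::'v set). norm z / real DIM('v))"
    using lt by (intro sum_strict_mono) (auto simp: inner_commute)
  also have "\<dots> = norm z" by simp
  finally show False by simp
qed

lemma exp_norm_le_sum:
  fixes x :: "'v::euclidean_space"
  assumes "t \<ge> 0"
  shows "exp (t * norm x) \<le> (\<Sum>b\<in>Basis. exp (((t * DIM('v)) *\<^sub>R b) \<bullet> x) + exp ((- (t * DIM('v)) *\<^sub>R b) \<bullet> x))"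
proof -
  obtain b :: 'v where b: "b \<in> Basis" "norm x \<le> real DIM('v) * \<bar>b \<bullet> x\<bar>"
    using ex_Basis_norm_le by blast
  have "t * norm x \<le> t * (DIM('v) * \<bar>b \<bullet> x\<bar>)" using b assms by (intro mult_left_mono)
  also have "\<dots> = \<bar>((t * DIM('v)) *\<^sub>R b) \<bullet> x\<bar>" using assms by (simp add: abs_mult)
  finally have "exp (t * norm x) \<le> exp \<bar>((t * DIM('v)) *\<^sub>R b) \<bullet> x\<bar>" by simp
  also have "\<dots> \<le> exp (((t * DIM('v)) *\<^sub>R b) \<bullet> x) + exp ((- (t * DIM('v)) *\<^sub>R b) \<bullet> x)"
    by (simp add: abs_if)
  also have "\<dots> \<le> (\<Sum>b\<in>Basis. exp (((t * DIM('v)) *\<^sub>R b) \<bullet> x) + exp ((- (t * DIM('v)) *\<^sub>R b) \<bullet> x))"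
    using b by (intro member_le_sum) (auto intro: add_nonneg_nonneg)
  finally show ?thesis .
qed

text \<open>A second-order Taylor bound valid on the whole line. After substituting
  \<open>u \<bullet> X\<close> its remainder is integrable, which replaces differentiation under the
  integral.\<close>

lemma exp_le_quadratic:
  fixes z :: real
  shows "exp z \<le> 1 + z + z\<^sup>2 * exp \<bar>z\<bar>"
proof -
  have a: "1 - z \<le> exp (- z)" using exp_ge_add_one_self[of "-z"] by linarith
  have "(1 - z) * exp z \<le> exp (- z) * exp z" using a by (intro mult_right_mono) auto
  then have 1: "exp z - 1 \<le> z * exp z" by (simp add: algebra_simps flip: exp_add)
  have 2: "z \<le> exp z - 1" using exp_ge_add_one_self[of z] by linarith
  have 3: "\<bar>exp z - 1\<bar> \<le> \<bar>z\<bar> * exp \<bar>z\<bar>"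
  proof (cases "z \<ge> 0")
    case True
    with 1 2 show ?thesis by simp
  next
    case False
    have "\<bar>exp z - 1\<bar> \<le> \<bar>z\<bar> * 1" using False 2 by simp
    also have "\<dots> \<le> \<bar>z\<bar> * exp \<bar>z\<bar>" by (intro mult_left_mono) auto
    finally show ?thesis .
  qed
  have "exp z - 1 - z \<le> z * (exp z - 1)" using 1 by (simp add: algebra_simps)
  also have "\<dots> \<le> \<bar>z\<bar> * \<bar>exp z - 1\<bar>" by (metis abs_ge_self abs_mult)
  also have "\<dots> \<le> \<bar>z\<bar> * (\<bar>z\<bar> * exp \<bar>z\<bar>)" using 3 by (intro mult_left_mono) auto
  also have "\<dots> = z\<^sup>2 * exp \<bar>z\<bar>" by (simp add: power2_eq_square)
  finally show ?thesis by simp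
qed

text \<open>Testing with \<open>p\<close> rescaled to length \<open>t\<close>, dividing by
  \<open>t\<close> and letting \<open>t\<close> tend to 0 removes the quadratic term. The lemma
  reads gradients off one-sided bounds; with \<open>e = 0\<close> it forces
  \<open>p = 0\<close>.\<close>

lemma norm_le_of_inner_le_quadratic:
  fixes p :: "'v::real_inner"
  assumes "\<And>u. norm u \<le> \<rho> \<Longrightarrow> u \<bullet> p \<le> e * norm u + K * (norm u)\<^sup>2"
    and "e \<ge> 0" and "\<rho> > 0"
  shows "norm p \<le> e"
proof (cases "p = 0")
  case False
  have *: "norm p \<le> e + K * t" if "0 < t" "t \<le> \<rho>" for t
  proof -
    let ?u = "(t / norm p) *\<^sub>R p"
    have "norm ?u = t" using False that by simp
    moreover have "?u \<bullet> p = t * norm p"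
      by (simp add: dot_square_norm power2_eq_square)
    ultimately have "t * norm p \<le> e * t + K * t\<^sup>2" using assms(1)[of ?u] that by simp
    then have "t * norm p \<le> t * (e + K * t)" by (simp add: algebra_simps power2_eq_square)
    then show ?thesis using that by simp
  qed
  have "((\<lambda>t. e + K * t) \<longlongrightarrow> e + K * 0) (at_right 0)" by (intro tendsto_intros)
  moreover have "eventually (\<lambda>t. norm p \<le> e + K * t) (at_right 0)"
    using eventually_at_right[of 0 \<rho>] * assms(3) by (auto intro!: exI[of _ \<rho>])
  ultimately show ?thesis
    by (metis add.right_neutral mult_zero_right tendsto_lowerbound trivial_limit_at_right_real)
qed (use assms in auto)

context prob_space
begin

text \<open>Integrability is recorded explicitly because a Bochner integral that does not exist is
  0, so \<open>mgf\<close> alone would not reveal an infinite moment.\<close>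

definition has_exp_moments :: "('a \<Rightarrow> 'v::euclidean_space) \<Rightarrow> bool" where
  "has_exp_moments X \<longleftrightarrow> X \<in> borel_measurable M \<and> (\<forall>l. integrable M (\<lambda>\<omega>. exp (l \<bullet> X \<omega>)))"

definition mgf :: "('a \<Rightarrow> 'v::euclidean_space) \<Rightarrow> 'v \<Rightarrow> real" where
  "mgf X l = expectation (\<lambda>\<omega>. exp (l \<bullet> X \<omega>))"

lemma has_exp_momentsD:
  assumes "has_exp_moments X"
  shows "X \<in> borel_measurable M" "integrable M (\<lambda>\<omega>. exp (l \<bullet> X \<omega>))"
  using assms by (auto simp: has_exp_moments_def)

lemma integrable_exp_norm:
  fixes X :: "'a \<Rightarrow> 'v::euclidean_space"
  assumes X: "has_exp_moments X" and t: "t \<ge> 0"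
  shows "integrable M (\<lambda>\<omega>. exp (t * norm (X \<omega>)))"
proof (rule Bochner_Integration.integrable_bound)
  show "integrable M (\<lambda>\<omega>. \<Sum>b\<in>Basis. exp (((t * DIM('v)) *\<^sub>R b) \<bullet> X \<omega>) + exp ((- (t * DIM('v)) *\<^sub>R b) \<bullet> X \<omega>))"
    using X by (intro Bochner_Integration.integrable_sum Bochner_Integration.integrable_add has_exp_momentsD)
  show "(\<lambda>\<omega>. exp (t * norm (X \<omega>))) \<in> borel_measurable M"
    using has_exp_momentsD(1)[OF X] by measurable
  show "AE \<omega> in M. norm (exp (t * norm (X \<omega>))) \<le> norm (\<Sum>b\<in>Basis. exp (((t * DIM('v)) *\<^sub>R b) \<bullet> X \<omega>) + exp ((- (t * DIM('v)) *\<^sub>R b) \<bullet> X \<omega>))"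
  proof (rule AE_I2)
    fix \<omega>
    show "norm (exp (t * norm (X \<omega>))) \<le> norm (\<Sum>b\<in>Basis. exp (((t * DIM('v)) *\<^sub>R b) \<bullet> X \<omega>) + exp ((- (t * DIM('v)) *\<^sub>R b) \<bullet> X \<omega>))"
      using exp_norm_le_sum[OF t, of "X \<omega>"] by (simp add: abs_le_iff)
  qed
qed

lemma expectation_exp_norm_le:
  fixes X :: "'a \<Rightarrow> 'v::euclidean_space"
  assumes X: "has_exp_moments X" and t: "t \<ge> 0"
  shows "expectation (\<lambda>\<omega>. exp (t * norm (X \<omega>)))
    \<le> (\<Sum>b\<in>Basis. mgf X ((t * DIM('v)) *\<^sub>R b) + mgf X (- (t * DIM('v)) *\<^sub>R b))"
proof -
  have "expectation (\<lambda>\<omega>. exp (t * norm (X \<omega>))) \<le> expectation (\<lambda>\<omega>. \<Sum>b\<in>Basis. exp (((t * DIM('v)) *\<^sub>R b) \<bullet> X \<omega>) + exp ((- (t * DIM('v)) *\<^sub>R b) \<bullet> X \<omega>))"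
    using X by (intro integral_mono integrable_exp_norm t exp_norm_le_sum
      Bochner_Integration.integrable_sum Bochner_Integration.integrable_add has_exp_momentsD)
  also have "\<dots> = (\<Sum>b\<in>Basis. mgf X ((t * DIM('v)) *\<^sub>R b) + mgf X (- (t * DIM('v)) *\<^sub>R b))"
    unfolding mgf_def using X
    by (subst Bochner_Integration.integral_sum)
      (auto intro!: has_exp_momentsD sum.cong Bochner_Integration.integral_add Bochner_Integration.integrable_add
        simp del: inner_scaleR_left inner_minus_left)
  finally show ?thesis .
qed

lemma mgf_le_exp_norm:
  assumes X: "has_exp_moments X" and "norm l \<le> t"
  shows "mgf X l \<le> expectation (\<lambda>\<omega>. exp (t * norm (X \<omega>)))"
proof -
  have "0 \<le> t" using assms(2) norm_ge_zero order_trans by blast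
  moreover have "l \<bullet> x \<le> t * norm x" for x
    using assms(2) by (meson mult_right_mono norm_cauchy_schwarz norm_ge_zero order_trans)
  ultimately show ?thesis
    unfolding mgf_def using X by (intro integral_mono integrable_exp_norm has_exp_momentsD) auto
qed

lemma mgf_pos:
  assumes "has_exp_moments X"
  shows "mgf X l > 0"
  unfolding mgf_def
  using integral_less_AE_space[of "\<lambda>_. 0" "\<lambda>\<omega>. exp (l \<bullet> X \<omega>)"] has_exp_momentsD(2)[OF assms, of l]
  by (simp add: emeasure_space_1)

lemma mgf_zero [simp]: "mgf X 0 = 1"
  by (simp add: mgf_def prob_space)

lemma has_exp_moments_integrable:
  assumes "has_exp_moments X"
  shows "integrable M (\<lambda>\<omega>. exp (l \<bullet> X \<omega>) *\<^sub>R X \<omega>)" "integrable M X"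
proof -
  have *: "integrable M (\<lambda>\<omega>. exp (l \<bullet> X \<omega>) *\<^sub>R X \<omega>)" for l
  proof (rule Bochner_Integration.integrable_bound[OF integrable_exp_norm[OF assms, of "norm l + 1"]])
    show "(\<lambda>\<omega>. exp (l \<bullet> X \<omega>) *\<^sub>R X \<omega>) \<in> borel_measurable M"
      using has_exp_momentsD(1)[OF assms] by measurable
    have "exp (l \<bullet> x) * norm x \<le> exp ((norm l + 1) * norm x)" for x
    proof -
      have "exp (l \<bullet> x) * norm x \<le> exp (norm l * norm x) * exp (norm x)"
        using norm_cauchy_schwarz[of l x] exp_ge_add_one_self[of "norm x"]
        by (intro mult_mono) (simp, linarith, auto)
      then show ?thesis by (simp add: exp_add[symmetric] algebra_simps)
    qed
    then show "AE \<omega> in M. norm (exp (l \<bullet> X \<omega>) *\<^sub>R X \<omega>) \<le> norm (exp ((norm l + 1) * norm (X \<omega>)))"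
      by simp
  qed simp
  from this[of l] show "integrable M (\<lambda>\<omega>. exp (l \<bullet> X \<omega>) *\<^sub>R X \<omega>)" .
  from *[of 0] show "integrable M X" by simp
qed

text \<open>\<open>G\<close> is the gradient of \<open>mgf X\<close> at \<open>l\<close>. Both
  bounds are pointwise bounds on \<open>exp (u \<bullet> X)\<close>, multiplied by
  \<open>exp (l \<bullet> X)\<close> and integrated. In \<open>norm l + 2\<close> the first summand
  comes from \<open>exp (l \<bullet> X)\<close>, one unit absorbs the factor
  \<open>(norm X)\<^sup>2\<close>, and one bounds \<open>exp \<bar>u \<bullet> X\<bar>\<close> for
  \<open>norm u \<le> 1\<close>.\<close>

lemma mgf_expansion:
  fixes X :: "'a \<Rightarrow> 'v::euclidean_space" and l :: 'v
  assumes X: "has_exp_moments X"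
  defines "G \<equiv> expectation (\<lambda>\<omega>. exp (l \<bullet> X \<omega>) *\<^sub>R X \<omega>)"
  shows "mgf X l + u \<bullet> G \<le> mgf X (l + u)"
    and "norm u \<le> 1 \<Longrightarrow> mgf X (l + u) \<le> mgf X l + u \<bullet> G
      + 2 * expectation (\<lambda>\<omega>. exp ((norm l + 2) * norm (X \<omega>))) * (norm u)\<^sup>2"
proof -
  have int: "integrable M (\<lambda>\<omega>. u \<bullet> (exp (l \<bullet> X \<omega>) *\<^sub>R X \<omega>))"
    using has_exp_moments_integrable[OF X] by (intro integrable_inner_right) auto
  have uG: "u \<bullet> G = expectation (\<lambda>\<omega>. u \<bullet> (exp (l \<bullet> X \<omega>) *\<^sub>R X \<omega>))"
    unfolding G_def using has_exp_moments_integrable[OF X] by (intro integral_inner_right[symmetric]) auto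
  note intl = has_exp_momentsD(2)[OF X]
  have "mgf X l + u \<bullet> G = expectation (\<lambda>\<omega>. exp (l \<bullet> X \<omega>) + u \<bullet> (exp (l \<bullet> X \<omega>) *\<^sub>R X \<omega>))"
    unfolding mgf_def uG using intl int by (intro Bochner_Integration.integral_add[symmetric])
  also have "\<dots> \<le> mgf X (l + u)" unfolding mgf_def
  proof (intro integral_mono Bochner_Integration.integrable_add intl int)
    fix \<omega>
    have "exp (l \<bullet> X \<omega>) * (1 + u \<bullet> X \<omega>) \<le> exp (l \<bullet> X \<omega>) * exp (u \<bullet> X \<omega>)"
      by (intro mult_left_mono) (auto simp: exp_ge_add_one_self)
    then show "exp (l \<bullet> X \<omega>) + u \<bullet> (exp (l \<bullet> X \<omega>) *\<^sub>R X \<omega>) \<le> exp ((l + u) \<bullet> X \<omega>)"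
      by (simp add: algebra_simps exp_add)
  qed
  finally show "mgf X l + u \<bullet> G \<le> mgf X (l + u)" .
  assume u: "norm u \<le> 1"
  let ?E = "\<lambda>\<omega>. exp ((norm l + 2) * norm (X \<omega>))"
  have intE: "integrable M ?E" using X by (intro integrable_exp_norm) auto
  have "mgf X (l + u) \<le> expectation (\<lambda>\<omega>. exp (l \<bullet> X \<omega>) + u \<bullet> (exp (l \<bullet> X \<omega>) *\<^sub>R X \<omega>) + ?E \<omega> * (2 * (norm u)\<^sup>2))"
    unfolding mgf_def
  proof (intro integral_mono Bochner_Integration.integrable_add intl int integrable_mult_left intE)
    fix \<omega>
    let ?x = "X \<omega>"
    have ux: "\<bar>u \<bullet> ?x\<bar> \<le> norm u * norm ?x" by (rule Cauchy_Schwarz_ineq2)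
    have ux1: "norm u * norm ?x \<le> norm ?x" using u by (simp add: mult_left_le_one_le)
    have q: "(norm ?x)\<^sup>2 \<le> 2 * exp (norm ?x)"
      using exp_lower_Taylor_quadratic[of "norm ?x"] norm_ge_zero[of ?x] by linarith
    have "(u \<bullet> ?x)\<^sup>2 \<le> (norm u * norm ?x)\<^sup>2" using ux by (simp add: abs_le_square_iff[symmetric])
    also have "\<dots> \<le> (norm u)\<^sup>2 * (2 * exp (norm ?x))"
      unfolding power_mult_distrib using q by (intro mult_left_mono) auto
    finally have sq: "(u \<bullet> ?x)\<^sup>2 \<le> (norm u)\<^sup>2 * (2 * exp (norm ?x))" .
    have "(u \<bullet> ?x)\<^sup>2 * exp \<bar>u \<bullet> ?x\<bar> \<le> (norm u)\<^sup>2 * (2 * exp (norm ?x)) * exp (norm ?x)"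
      using sq ux ux1 by (intro mult_mono) auto
    then have "exp (u \<bullet> ?x) \<le> 1 + u \<bullet> ?x + (norm u)\<^sup>2 * (2 * exp (norm ?x)) * exp (norm ?x)"
      using exp_le_quadratic[of "u \<bullet> ?x"] by linarith
    then have "exp (l \<bullet> ?x) * exp (u \<bullet> ?x) \<le> exp (l \<bullet> ?x) * (1 + u \<bullet> ?x + (norm u)\<^sup>2 * (2 * exp (norm ?x)) * exp (norm ?x))"
      by (intro mult_left_mono) auto
    also have "\<dots> = exp (l \<bullet> ?x) * (1 + u \<bullet> ?x) + exp (l \<bullet> ?x) * ((norm u)\<^sup>2 * (2 * exp (norm ?x)) * exp (norm ?x))"
      by (simp add: algebra_simps)
    also have "\<dots> \<le> exp (l \<bullet> ?x) * (1 + u \<bullet> ?x) + exp (norm l * norm ?x) * ((norm u)\<^sup>2 * (2 * exp (norm ?x)) * exp (norm ?x))"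
      using norm_cauchy_schwarz[of l ?x] by (intro add_left_mono mult_right_mono) auto
    also have "exp (norm l * norm ?x) * ((norm u)\<^sup>2 * (2 * exp (norm ?x)) * exp (norm ?x)) = ?E \<omega> * (2 * (norm u)\<^sup>2)"
    proof -
      have "(norm l + 2) * norm ?x = norm l * norm ?x + norm ?x + norm ?x" by (simp add: algebra_simps)
      then have "?E \<omega> = exp (norm l * norm ?x) * exp (norm ?x) * exp (norm ?x)"
        by (simp only: exp_add)
      then show ?thesis by (simp only: mult_ac)
    qed
    finally show "exp ((l + u) \<bullet> ?x) \<le> exp (l \<bullet> ?x) + u \<bullet> (exp (l \<bullet> ?x) *\<^sub>R ?x) + ?E \<omega> * (2 * (norm u)\<^sup>2)"
      by (simp add: algebra_simps exp_add)
  qed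
  also have "\<dots> = mgf X l + u \<bullet> G + expectation ?E * (2 * (norm u)\<^sup>2)"
    unfolding mgf_def uG using intl int intE by simp
  finally show "mgf X (l + u) \<le> mgf X l + u \<bullet> G + 2 * expectation ?E * (norm u)\<^sup>2"
    by (simp add: algebra_simps)
qed

lemma isCont_mgf:
  assumes X: "has_exp_moments X"
  shows "isCont (mgf X) l"
proof -
  define G where "G = expectation (\<lambda>\<omega>. exp (l \<bullet> X \<omega>) *\<^sub>R X \<omega>)"
  define K where "K = 2 * expectation (\<lambda>\<omega>. exp ((norm l + 2) * norm (X \<omega>)))"
  have "((\<lambda>u. mgf X (l + u)) \<longlongrightarrow> mgf X l) (at 0)"
  proof (rule tendsto_sandwich)
    have ev: "eventually (\<lambda>u::'b. norm u \<le> 1) (at 0)"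
      by (auto simp: eventually_at intro!: exI[of _ 1])
    show "eventually (\<lambda>u. mgf X l + u \<bullet> G \<le> mgf X (l + u)) (at 0)"
      using mgf_expansion(1)[OF X] by (simp add: G_def)
    show "eventually (\<lambda>u. mgf X (l + u) \<le> mgf X l + u \<bullet> G + K * (norm u)\<^sup>2) (at 0)"
      using ev by eventually_elim (use mgf_expansion(2)[OF X] in \<open>auto simp: G_def K_def\<close>)
    have "((\<lambda>u. mgf X l + u \<bullet> G) \<longlongrightarrow> mgf X l + 0 \<bullet> G) (at 0)"
      by (intro tendsto_intros)
    then show "((\<lambda>u. mgf X l + u \<bullet> G) \<longlongrightarrow> mgf X l) (at 0)" by simp
    have "((\<lambda>u. mgf X l + u \<bullet> G + K * (norm u)\<^sup>2) \<longlongrightarrow> mgf X l + 0 \<bullet> G + K * (norm (0::'b))\<^sup>2) (at 0)"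
      by (intro tendsto_intros)
    then show "((\<lambda>u. mgf X l + u \<bullet> G + K * (norm u)\<^sup>2) \<longlongrightarrow> mgf X l) (at 0)" by simp
  qed
  then show ?thesis unfolding isCont_def by (rule LIM_offset_zero_cancel)
qed

text \<open>The vector \<open>m\<close> is the mean of \<open>X\<close> under the measure tilted by
  \<open>exp (l \<bullet> X)\<close>. The logarithm is removed by \<open>ln a \<le> a - 1\<close>,
  applied to the ratio of the two moment generating functions.\<close>

lemma ln_mgf_le_quadratic:
  assumes X: "has_exp_moments X"
  shows "\<exists>m K. K \<ge> 0 \<and> (\<forall>u. norm u \<le> 1 \<longrightarrow> ln (mgf X (l + u)) \<le> ln (mgf X l) + u \<bullet> m + K * (norm u)\<^sup>2)
    \<and> (l = 0 \<longrightarrow> m = expectation X)"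
proof (intro exI conjI allI impI)
  let ?G = "expectation (\<lambda>\<omega>. exp (l \<bullet> X \<omega>) *\<^sub>R X \<omega>)"
  let ?K = "2 * expectation (\<lambda>\<omega>. exp ((norm l + 2) * norm (X \<omega>)))"
  let ?m = "(1 / mgf X l) *\<^sub>R ?G"
  note pos = mgf_pos[OF X]
  show "?K / mgf X l \<ge> 0" using pos[of l] by (simp add: integral_nonneg_AE)
  show "l = 0 \<Longrightarrow> ?m = expectation X" by simp
  fix u :: 'b assume u: "norm u \<le> 1"
  have "ln (mgf X (l + u)) - ln (mgf X l) = ln (mgf X (l + u) / mgf X l)"
    using pos[of l] pos[of "l+u"] by (simp add: ln_div)
  also have "\<dots> \<le> mgf X (l + u) / mgf X l - 1"
    using pos[of l] pos[of "l+u"] by (intro ln_le_minus_one) auto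
  also have "\<dots> \<le> (mgf X l + u \<bullet> ?G + ?K * (norm u)\<^sup>2) / mgf X l - 1"
    using mgf_expansion(2)[OF X u, of l] pos[of l] by (intro diff_right_mono divide_right_mono) auto
  also have "\<dots> = u \<bullet> ?m + ?K / mgf X l * (norm u)\<^sup>2"
    using pos[of l] by (simp add: field_simps)
  finally show "ln (mgf X (l + u)) \<le> ln (mgf X l) + u \<bullet> ?m + ?K / mgf X l * (norm u)\<^sup>2" by simp
qed

section \<open>Jensen bounds, comparison of moment generating functions, exponential tilting\<close>

text \<open>Jensen's inequality, obtained by integrating the tangent of \<open>exp\<close> at the
  mean of \<open>u \<bullet> X\<close>.\<close>

lemma inner_expectation_le_ln_mgf:
  assumes X: "has_exp_moments X"
  shows "u \<bullet> expectation X \<le> ln (mgf X u)"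
proof -
  let ?s = "u \<bullet> expectation X"
  have int: "integrable M (\<lambda>\<omega>. u \<bullet> X \<omega>)"
    using has_exp_moments_integrable[OF X] by (intro integrable_inner_right) auto
  have s: "?s = expectation (\<lambda>\<omega>. u \<bullet> X \<omega>)"
    using has_exp_moments_integrable[OF X] by (intro integral_inner_right[symmetric]) auto
  have "exp ?s = expectation (\<lambda>\<omega>. exp ?s * (1 + (u \<bullet> X \<omega> - ?s)))"
    using int by (simp add: s prob_space)
  also have "\<dots> \<le> mgf X u" unfolding mgf_def
  proof (intro integral_mono has_exp_momentsD[OF X])
    show "integrable M (\<lambda>\<omega>. exp ?s * (1 + (u \<bullet> X \<omega> - ?s)))" using int by simp
    fix \<omega>
    have "exp ?s * (1 + (u \<bullet> X \<omega> - ?s)) \<le> exp ?s * exp (u \<bullet> X \<omega> - ?s)"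
      by (intro mult_left_mono exp_ge_add_one_self) auto
    then show "exp ?s * (1 + (u \<bullet> X \<omega> - ?s)) \<le> exp (u \<bullet> X \<omega>)" by (simp flip: exp_add)
  qed
  finally show ?thesis using mgf_pos[OF X] ln_ge_iff by blast
qed

text \<open>The means in Jensen's inequality at \<open>l\<close> and at \<open>- l\<close> cancel.
  An upper bound at \<open>- l\<close> thus becomes a lower bound at \<open>l\<close>, against which
  bad-event terms can be absorbed.\<close>

lemma one_le_mgf_mult:
  assumes X: "has_exp_moments X"
  shows "1 \<le> mgf X l * mgf X (- l)"
proof -
  have "0 \<le> ln (mgf X l) + ln (mgf X (- l))"
    using inner_expectation_le_ln_mgf[OF X, of l] inner_expectation_le_ln_mgf[OF X, of "- l"] by simp
  then have "0 \<le> ln (mgf X l * mgf X (- l))" using mgf_pos[OF X] by (simp add: ln_mult)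
  then show ?thesis using mgf_pos[OF X] by (simp add: ln_ge_zero_iff)
qed

text \<open>On the bad event \<open>2 exp (l \<bullet> X) \<le> s exp (2 l \<bullet> X) + 1/s\<close>, with \<open>s\<close> chosen so that both
  terms are negligible against the lower bound \<open>1 / mgf X (- l)\<close> of \<open>mgf X l\<close>.\<close>

lemma mgf_le_of_exp_close:
  assumes X: "has_exp_moments X" and Y: "has_exp_moments Y"
    and b: "mgf X (2 *\<^sub>R l) \<le> exp (b * v)" "mgf X (- l) \<le> exp (b * v)"
    and close: "prob {\<omega> \<in> space M. norm (X \<omega> - Y \<omega>) > e * v} \<le> exp (- C * v)"
    and C: "C \<ge> 3 * b + 4" and v: "v \<ge> 1" and e: "e \<ge> 0"
  shows "mgf X l \<le> 2 * exp (norm l * e * v) * mgf Y l"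
proof -
  define A where "A = {\<omega> \<in> space M. norm (X \<omega> - Y \<omega>) > e * v}"
  define s where "s = exp (- (2 * b + 2) * v)"
  have s: "s > 0" by (simp add: s_def)
  have [measurable]: "X \<in> borel_measurable M" "Y \<in> borel_measurable M"
    using X Y has_exp_momentsD by auto
  have A[measurable]: "A \<in> events" unfolding A_def by measurable
  have intA: "integrable M (indicator A :: 'a \<Rightarrow> real)" by (intro integrable_real_indicator) (auto simp: emeasure_eq_measure)
  have "mgf X l \<le> expectation (\<lambda>\<omega>. exp (norm l * e * v) * exp (l \<bullet> Y \<omega>)
     + (s / 2 * exp ((2 *\<^sub>R l) \<bullet> X \<omega>) + 1 / (2 * s) * indicator A \<omega>))" unfolding mgf_def
  proof (intro integral_mono has_exp_momentsD[OF X] Bochner_Integration.integrable_add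
      integrable_mult_right has_exp_momentsD[OF Y] intA)
    fix \<omega> assume \<omega>: "\<omega> \<in> space M"
    show "exp (l \<bullet> X \<omega>) \<le> exp (norm l * e * v) * exp (l \<bullet> Y \<omega>)
     + (s / 2 * exp ((2 *\<^sub>R l) \<bullet> X \<omega>) + 1 / (2 * s) * indicator A \<omega>)"
    proof (cases "\<omega> \<in> A")
      case True
      let ?a = "exp (l \<bullet> X \<omega>)"
      have "exp ((2 *\<^sub>R l) \<bullet> X \<omega>) = ?a * ?a" by (simp flip: exp_add)
      moreover have "0 \<le> (s * ?a - 1)\<^sup>2 / (2 * s)" using s by simp
      moreover have "(s * ?a - 1)\<^sup>2 / (2 * s) = s / 2 * (?a * ?a) + 1 / (2 * s) - ?a"
        using s by (simp add: field_simps power2_eq_square)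
      ultimately have "?a \<le> s / 2 * exp ((2 *\<^sub>R l) \<bullet> X \<omega>) + 1 / (2 * s) * indicator A \<omega>"
        using True by simp
      then show ?thesis by (simp add: add_increasing)
    next
      case False
      then have n: "norm (X \<omega> - Y \<omega>) \<le> e * v" using \<omega> by (auto simp: A_def)
      have "l \<bullet> X \<omega> = l \<bullet> Y \<omega> + l \<bullet> (X \<omega> - Y \<omega>)" by (simp add: algebra_simps)
      also have "l \<bullet> (X \<omega> - Y \<omega>) \<le> norm l * (e * v)"
        using n by (meson mult_left_mono norm_cauchy_schwarz norm_ge_zero order_trans)
      finally have "exp (l \<bullet> X \<omega>) \<le> exp (norm l * e * v) * exp (l \<bullet> Y \<omega>)"
        by (simp flip: exp_add add: algebra_simps)
      moreover have "0 \<le> s / 2 * exp ((2 *\<^sub>R l) \<bullet> X \<omega>) + 1 / (2 * s) * indicator A \<omega>"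
        using s by simp
      ultimately show ?thesis by linarith
    qed
  qed
  also have "\<dots> = exp (norm l * e * v) * mgf Y l + (s / 2 * mgf X (2 *\<^sub>R l) + 1 / (2 * s) * prob A)"
    unfolding mgf_def using has_exp_momentsD(2)[OF X, of "2 *\<^sub>R l"] has_exp_momentsD(2)[OF Y, of l] intA A
    by simp
  also have "s / 2 * mgf X (2 *\<^sub>R l) + 1 / (2 * s) * prob A \<le> s / 2 * exp (b * v) + 1 / (2 * s) * exp (- C * v)"
    using b close s unfolding A_def by (intro add_mono mult_left_mono) auto
  \<comment> \<open>Each summand is at most \<open>exp (- b * v) / 4\<close>. For the second,
    division by \<open>s\<close> leaves the exponent \<open>(2 * b + 2 - C) * v\<close>, and
    \<open>C \<ge> 3 * b + 4\<close> is exactly what brings it below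
    \<open>(- b - 2) * v\<close>.\<close>
  also have "\<dots> \<le> exp (- b * v) / 2"
  proof -
    have h: "exp (- 2 * v) \<le> (1/2::real)"
    proof -
      have "exp (- 2 * v) \<le> exp (- (1::real))" using v by simp
      also have "\<dots> \<le> 1 / 2"
        using exp_ge_add_one_self[of "1::real"] by (simp add: exp_minus field_simps)
      finally show ?thesis .
    qed
    have "s * exp (b * v) = exp (- b * v) * exp (- 2 * v)"
      by (simp add: s_def algebra_simps flip: exp_add)
    also have "\<dots> \<le> exp (- b * v) * (1 / 2)" using h by (intro mult_left_mono) auto
    finally have 1: "s * exp (b * v) \<le> exp (- b * v) / 2" by simp
    have "exp (- C * v) / s = exp ((2 * b + 2 - C) * v)"
      by (simp add: s_def algebra_simps flip: exp_diff)
    also have "\<dots> \<le> exp ((- b - 2) * v)" using C v by (intro exp_le_cancel_iff[THEN iffD2] mult_right_mono) auto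
    also have "\<dots> = exp (- b * v) * exp (- 2 * v)" by (simp add: algebra_simps flip: exp_add)
    also have "\<dots> \<le> exp (- b * v) * (1 / 2)" using h by (intro mult_left_mono) auto
    finally have 2: "exp (- C * v) / s \<le> exp (- b * v) / 2" by simp
    show ?thesis using 1 2 by (simp add: field_simps)
  qed
  \<comment> \<open>Half of the left-hand side of the claim is absorbed, which is the origin of the
    factor 2 there.\<close>
  also have "exp (- b * v) / 2 \<le> mgf X l / 2"
  proof -
    have "1 \<le> mgf X l * exp (b * v)"
      using one_le_mgf_mult[OF X, of l] b(2) mgf_pos[OF X, of l]
      by (meson mult_left_mono less_imp_le order_trans)
    then show ?thesis by (simp add: exp_minus field_simps)
  qed
  finally show ?thesis by simp
qed

text \<open>The usual change of measure with density proportional to \<open>exp (l \<bullet> Y)\<close>; the concentration of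
  \<open>Y\<close> around \<open>a *\<^sub>R y\<close> under the tilted measure is again obtained from exponential moments.\<close>

lemma tilted_lower_bound:
  fixes c :: "'v::euclidean_space \<Rightarrow> real"
  assumes c: "\<And>u. norm u \<le> 1 \<Longrightarrow> c (l + u) \<le> c l + u \<bullet> y + K * (norm u)\<^sup>2"
    and \<eta>: "\<eta> > 0"
  shows "\<exists>\<kappa>>0. \<forall>Y a. a > 0 \<longrightarrow> has_exp_moments Y \<longrightarrow> (\<forall>l. mgf Y l = exp (a * c l)) \<longrightarrow>
    (1 - 2 * real DIM('v) * exp (- \<kappa> * a)) * exp (- a * (l \<bullet> y - c l + norm l * \<eta>))
      \<le> prob {\<omega> \<in> space M. norm (Y \<omega> - a *\<^sub>R y) \<le> \<eta> * a}"
proof -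
  define D where "D = real DIM('v)"
  have D: "D > 0" by (simp add: D_def)
  \<comment> \<open>The size of the additional tilt. The cap 1 keeps \<open>t *\<^sub>R b\<close>
    within reach of \<open>c\<close>; the other cap gives
    \<open>K * t \<le> \<eta> / (2 * D)\<close>, so the quadratic cost uses at most half of the gain
    \<open>t * \<eta> / D\<close> and the other half remains as \<open>\<kappa>\<close>. Both are
    fixed before \<open>Y\<close> and \<open>a\<close>, so one rate serves a whole sequence.\<close>
  define t where "t = min 1 (\<eta> / (2 * D * (\<bar>K\<bar> + 1)))"
  have t: "t > 0" "t \<le> 1" "t \<le> \<eta> / (2 * D * (\<bar>K\<bar> + 1))" using \<eta> D by (auto simp: t_def)
  define \<kappa> where "\<kappa> = t * \<eta> / (2 * D)"
  have \<kappa>: "\<kappa> > 0" using t \<eta> D by (simp add: \<kappa>_def)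
  have "K * t \<le> (\<bar>K\<bar> + 1) * t" using t by (intro mult_right_mono) auto
  also have "\<dots> \<le> (\<bar>K\<bar> + 1) * (\<eta> / (2 * D * (\<bar>K\<bar> + 1)))" using t by (intro mult_left_mono) auto
  also have "\<dots> = \<eta> / (2 * D)"
  proof -
    have "q * (\<eta> / (2 * D * q)) = \<eta> / (2 * D)" if "q > 0" for q
      using that D by (simp add: field_simps)
    then show ?thesis by simp
  qed
  finally have "t * (K * t) \<le> t * (\<eta> / (2 * D))" using t by (intro mult_left_mono) auto
  then have Kt: "K * t\<^sup>2 - t * \<eta> / D \<le> - \<kappa>"
    by (simp add: \<kappa>_def power2_eq_square field_simps)
  show ?thesis
  proof (intro exI[of _ \<kappa>] conjI allI impI \<kappa>)
    fix Y :: "'a \<Rightarrow> 'v" and a :: real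
    assume a: "a > 0" and Y: "has_exp_moments Y" and mgf: "\<forall>l. mgf Y l = exp (a * c l)"
    have [measurable]: "Y \<in> borel_measurable M" using Y has_exp_momentsD by auto
    define A where "A = {\<omega> \<in> space M. norm (Y \<omega> - a *\<^sub>R y) \<le> \<eta> * a}"
    have A[measurable]: "A \<in> events" unfolding A_def by measurable
    have intA: "integrable M (indicator A :: 'a \<Rightarrow> real)" by (intro integrable_real_indicator) (auto simp: emeasure_eq_measure)
    \<comment> \<open>Weights for a Markov bound:
      \<open>?q b * exp ((l + t *\<^sub>R b) \<bullet> Y \<omega>)\<close> exceeds
      \<open>exp (l \<bullet> Y \<omega>)\<close> as soon as the \<open>b\<close>-coordinate of
      \<open>Y \<omega> - a *\<^sub>R y\<close> reaches \<open>a * \<eta> / D\<close>. Outside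
      \<open>A\<close> this happens for some signed basis vector. On \<open>A\<close>, the number
      \<open>?m\<close> bounds \<open>exp (l \<bullet> Y \<omega>)\<close>.\<close>
    let ?q = "\<lambda>b. exp (- t * (b \<bullet> (a *\<^sub>R y)) - t * (a * \<eta> / D))"
    let ?m = "exp (a * (l \<bullet> y + norm l * \<eta>))"
    have "mgf Y l \<le> expectation (\<lambda>\<omega>. ?m * indicator A \<omega> + (\<Sum>b\<in>Basis. ?q b * exp ((l + t *\<^sub>R b) \<bullet> Y \<omega>)
        + ?q (- b) * exp ((l + t *\<^sub>R (- b)) \<bullet> Y \<omega>)))"
      unfolding mgf_def
    proof (intro integral_mono has_exp_momentsD[OF Y] Bochner_Integration.integrable_add
        Bochner_Integration.integrable_sum integrable_mult_right intA)
      fix \<omega> assume \<omega>: "\<omega> \<in> space M"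
      let ?z = "Y \<omega> - a *\<^sub>R y"
      have nn: "0 \<le> (\<Sum>b\<in>Basis. ?q b * exp ((l + t *\<^sub>R b) \<bullet> Y \<omega>)
        + ?q (- b) * exp ((l + t *\<^sub>R (- b)) \<bullet> Y \<omega>))"
        by (intro sum_nonneg) (simp add: add_nonneg_nonneg)
      show "exp (l \<bullet> Y \<omega>) \<le> ?m * indicator A \<omega> + (\<Sum>b\<in>Basis. ?q b * exp ((l + t *\<^sub>R b) \<bullet> Y \<omega>)
        + ?q (- b) * exp ((l + t *\<^sub>R (- b)) \<bullet> Y \<omega>))"
      proof (cases "\<omega> \<in> A")
        case True
        have "l \<bullet> ?z \<le> norm l * (\<eta> * a)" using True unfolding A_def
          by (smt (verit, best) mem_Collect_eq mult_left_mono norm_cauchy_schwarz norm_ge_zero)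
        then have "exp (l \<bullet> Y \<omega>) \<le> ?m * indicator A \<omega>" using True by (simp add: algebra_simps)
        then show ?thesis by (rule add_increasing2[OF nn])
      next
        case False
        then have n: "\<eta> * a < norm ?z" using \<omega> by (auto simp: A_def)
        obtain b :: 'v where b: "b \<in> Basis" "norm ?z \<le> D * \<bar>b \<bullet> ?z\<bar>"
          using ex_Basis_norm_le unfolding D_def by blast
        then have "\<bar>b \<bullet> ?z\<bar> \<ge> a * \<eta> / D" using n D by (simp add: field_simps)
        then have "a * \<eta> / D \<le> b \<bullet> ?z \<or> a * \<eta> / D \<le> - b \<bullet> ?z"
          by (simp only: inner_minus_left) linarith
        then have "t * (a * \<eta> / D) \<le> t * (b \<bullet> ?z) \<or> t * (a * \<eta> / D) \<le> t * (- b \<bullet> ?z)"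
          using t(1) by (meson less_imp_le mult_left_mono)
        have le_sum: "x \<le> p \<or> x \<le> q \<Longrightarrow> 0 \<le> p \<Longrightarrow> 0 \<le> q \<Longrightarrow> x \<le> p + q" for x p q :: real
          by auto
        note \<open>t * (a * \<eta> / D) \<le> t * (b \<bullet> ?z) \<or> t * (a * \<eta> / D) \<le> t * (- b \<bullet> ?z)\<close>
        moreover have eq: "?q b * exp ((l + t *\<^sub>R b) \<bullet> Y \<omega>) = exp (l \<bullet> Y \<omega> + (t * (b \<bullet> ?z) - t * (a * \<eta> / D)))" for b
          unfolding exp_add[symmetric] by (simp add: inner_add_left inner_diff_right right_diff_distrib)
        ultimately have "exp (l \<bullet> Y \<omega>) \<le> ?q b * exp ((l + t *\<^sub>R b) \<bullet> Y \<omega>)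
           \<or> exp (l \<bullet> Y \<omega>) \<le> ?q (- b) * exp ((l + t *\<^sub>R (- b)) \<bullet> Y \<omega>)"
          unfolding eq by (elim disj_forward) (subst exp_le_cancel_iff, linarith)+
        then have "exp (l \<bullet> Y \<omega>) \<le> ?q b * exp ((l + t *\<^sub>R b) \<bullet> Y \<omega>)
           + ?q (- b) * exp ((l + t *\<^sub>R (- b)) \<bullet> Y \<omega>)"
          by (rule le_sum) (intro mult_nonneg_nonneg exp_ge_zero)+
        also have "\<dots> \<le> (\<Sum>b\<in>Basis. ?q b * exp ((l + t *\<^sub>R b) \<bullet> Y \<omega>)
           + ?q (- b) * exp ((l + t *\<^sub>R (- b)) \<bullet> Y \<omega>))"
          using b by (intro member_le_sum) (auto intro: add_nonneg_nonneg)
        finally show ?thesis using False by simp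
      qed
    qed
    also have "\<dots> = ?m * prob A + (\<Sum>b\<in>Basis. ?q b * mgf Y (l + t *\<^sub>R b) + ?q (- b) * mgf Y (l + t *\<^sub>R (- b)))"
    proof -
      define h where "h b \<omega> = exp ((l + t *\<^sub>R b) \<bullet> Y \<omega>)" for b \<omega>
      define q where "q b = ?q b" for b
      have int: "integrable M (h b)" for b unfolding h_def by (rule has_exp_momentsD[OF Y])
      have "expectation (\<lambda>\<omega>. ?m * indicator A \<omega> + (\<Sum>b\<in>Basis. q b * h b \<omega> + q (- b) * h (- b) \<omega>))
        = ?m * prob A + (\<Sum>b\<in>Basis. q b * expectation (h b) + q (- b) * expectation (h (- b)))"
        using int intA A by simp
      then show ?thesis unfolding h_def q_def mgf_def .
    qed
    also have "(\<Sum>b\<in>Basis. ?q b * mgf Y (l + t *\<^sub>R b) + ?q (- b) * mgf Y (l + t *\<^sub>R (- b)))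
      \<le> (\<Sum>b\<in>(Basis::'v set). exp (a * c l) * exp (- \<kappa> * a) + exp (a * c l) * exp (- \<kappa> * a))"
    proof (intro sum_mono add_mono)
      have *: "?q b * mgf Y (l + t *\<^sub>R b) \<le> exp (a * c l) * exp (- \<kappa> * a)" if "norm b = 1" for b
      proof -
        have "a * c (l + t *\<^sub>R b) \<le> a * (c l + t * (b \<bullet> y) + K * t\<^sup>2)"
          using c[of "t *\<^sub>R b"] that t a by (intro mult_left_mono) auto
        moreover have "a * (K * t\<^sup>2 - t * \<eta> / D) \<le> a * (- \<kappa>)" using Kt a by (intro mult_left_mono) auto
        ultimately show ?thesis unfolding mgf[rule_format] exp_add[symmetric]
          by (subst exp_le_cancel_iff) (simp add: algebra_simps)
      qed
      fix b :: 'v assume "b \<in> Basis"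
      then have "norm b = 1" "norm (- b) = 1" by auto
      from *[OF this(1)] *[OF this(2)]
      show "?q b * mgf Y (l + t *\<^sub>R b) \<le> exp (a * c l) * exp (- \<kappa> * a)"
        "?q (- b) * mgf Y (l + t *\<^sub>R (- b)) \<le> exp (a * c l) * exp (- \<kappa> * a)" by blast+
    qed
    also have "\<dots> = 2 * D * exp (- \<kappa> * a) * exp (a * c l)" by (simp add: D_def)
    finally have "exp (a * c l) \<le> ?m * prob A + 2 * D * exp (- \<kappa> * a) * exp (a * c l)"
      using mgf by simp
    then have "(1 - 2 * D * exp (- \<kappa> * a)) * exp (a * c l) \<le> ?m * prob A"
      by (simp add: algebra_simps)
    then have "(1 - 2 * D * exp (- \<kappa> * a)) * exp (a * c l) / ?m \<le> prob A"
      by (subst pos_divide_le_eq) (simp_all only: exp_gt_zero mult.commute)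
    moreover have "exp (a * c l) / ?m = exp (- a * (l \<bullet> y - c l + norm l * \<eta>))"
      by (simp add: algebra_simps flip: exp_diff)
    ultimately show "(1 - 2 * real DIM('v) * exp (- \<kappa> * a)) * exp (- a * (l \<bullet> y - c l + norm l * \<eta>))
      \<le> prob {\<omega> \<in> space M. norm (Y \<omega> - a *\<^sub>R y) \<le> \<eta> * a}"
      unfolding A_def D_def times_divide_eq_right[symmetric] by simp
  qed
qed

end

section \<open>Limit of the scaled logarithmic moment generating functions\<close>

text \<open>The centre \<open>x\<close> may depend on the tolerance, so no candidate for the limit
  is required; completeness supplies it.\<close>

lemma convergent_if_eventually_near:
  fixes a :: "nat \<Rightarrow> 'b::complete_space"
  assumes "\<And>\<delta>. \<delta> > 0 \<Longrightarrow> \<exists>x. eventually (\<lambda>n. dist (a n) x \<le> \<delta>) sequentially"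
  shows "convergent a"
proof (rule Cauchy_convergent, rule metric_CauchyI)
  fix \<delta> :: real assume "\<delta> > 0"
  then obtain x N where N: "\<And>n. n \<ge> N \<Longrightarrow> dist (a n) x \<le> \<delta> / 3"
    using assms[of "\<delta> / 3"] by (auto simp: eventually_sequentially)
  have "dist (a m) (a n) < \<delta>" if "m \<ge> N" "n \<ge> N" for m n
    using N[OF that(1)] N[OF that(2)] \<open>\<delta> > 0\<close> dist_triangle2[of "a m" "a n" x] by linarith
  then show "\<exists>N. \<forall>m\<ge>N. \<forall>n\<ge>N. dist (a m) (a n) < \<delta>" by blast
qed

text \<open>The approximants \<open>Y n\<close> stand for sums of independent copies of \<open>S (k - r)\<close>; only the exact form
  of their moment generating function matters.\<close>

locale mgf_approx = prob_space M for M :: "'a measure" +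
  fixes S :: "nat \<Rightarrow> 'a \<Rightarrow> 'v::euclidean_space" and v :: "nat \<Rightarrow> real" and r :: nat
  assumes exp_moments: "n \<ge> 1 \<Longrightarrow> has_exp_moments (S n)"
    and v_ge_1: "n \<ge> 1 \<Longrightarrow> v n \<ge> 1"
    and v_at_top: "filterlim v at_top sequentially"
    and v_mono: "mono v"
    and v_shift: "(\<lambda>n. v (n + r) / v n) \<longlonglongrightarrow> 1"
    and exp_norm_bound: "t \<ge> 0 \<Longrightarrow> \<exists>B. \<forall>n\<ge>1. expectation (\<lambda>\<omega>. exp (t * norm (S n \<omega>))) \<le> exp (B * v n)"
    and approx: "e > 0 \<Longrightarrow> C > 0 \<Longrightarrow> \<exists>K>r. \<forall>k\<ge>K. \<exists>Y w.
        (\<forall>n. has_exp_moments (Y n)) \<and>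
        (\<forall>n l. mgf (Y n) l = exp (w n * (ln (mgf (S (k - r)) l) / v k))) \<and>
        eventually (\<lambda>n. 0 < w n \<and> w n \<le> v n) sequentially \<and>
        (\<lambda>n. w n / v n) \<longlonglongrightarrow> 1 \<and>
        eventually (\<lambda>n. prob {\<omega> \<in> space M. norm (S n \<omega> - Y n \<omega>) > e * v n} \<le> exp (- C * v n)) sequentially"
begin

definition c :: "nat \<Rightarrow> 'v \<Rightarrow> real" where
  "c k l = ln (mgf (S (k - r)) l) / v k"

definition approximant :: "nat \<Rightarrow> real \<Rightarrow> real \<Rightarrow> (nat \<Rightarrow> 'a \<Rightarrow> 'v) \<Rightarrow> (nat \<Rightarrow> real) \<Rightarrow> bool" where
  "approximant k e C Y w \<longleftrightarrow>
        (\<forall>n. has_exp_moments (Y n)) \<and>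
        (\<forall>n l. mgf (Y n) l = exp (w n * c k l)) \<and>
        eventually (\<lambda>n. 0 < w n \<and> w n \<le> v n) sequentially \<and>
        (\<lambda>n. w n / v n) \<longlonglongrightarrow> 1 \<and>
        eventually (\<lambda>n. prob {\<omega> \<in> space M. norm (S n \<omega> - Y n \<omega>) > e * v n} \<le> exp (- C * v n)) sequentially"

lemma ex_approximant:
  assumes "e > 0" "C > 0"
  shows "\<exists>K>r. \<forall>k\<ge>K. \<exists>Y w. approximant k e C Y w"
  using approx[OF assms] unfolding approximant_def c_def .

lemma eventually_v_ge: "eventually (\<lambda>n. v n \<ge> x) sequentially"
  using v_at_top by (simp add: filterlim_at_top)

lemma v_pos: "n \<ge> 1 \<Longrightarrow> v n > 0"
  using v_ge_1[of n] by simp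

lemma inverse_v_tendsto: "(\<lambda>n. x / v n) \<longlonglongrightarrow> 0"
  using v_at_top by (intro tendsto_divide_0[OF tendsto_const] filterlim_at_top_imp_at_infinity)

lemma mgf_bound:
  assumes "R \<ge> 0"
  obtains b where "b \<ge> 0" "\<And>n l. n \<ge> 1 \<Longrightarrow> norm l \<le> R \<Longrightarrow> mgf (S n) l \<le> exp (b * v n)"
    "\<And>n. n \<ge> 1 \<Longrightarrow> expectation (\<lambda>\<omega>. exp (R * norm (S n \<omega>))) \<le> exp (b * v n)"
proof -
  obtain B where B: "\<And>n. n \<ge> 1 \<Longrightarrow> expectation (\<lambda>\<omega>. exp (R * norm (S n \<omega>))) \<le> exp (B * v n)"
    using exp_norm_bound[OF assms] by blast
  show thesis
  proof (rule that[of "\<bar>B\<bar>"])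
    fix n :: nat assume n: "n \<ge> 1"
    have "expectation (\<lambda>\<omega>. exp (R * norm (S n \<omega>))) \<le> exp (B * v n)" using B[OF n] .
    also have "\<dots> \<le> exp (\<bar>B\<bar> * v n)" using v_pos[OF n] by simp
    finally show *: "expectation (\<lambda>\<omega>. exp (R * norm (S n \<omega>))) \<le> exp (\<bar>B\<bar> * v n)" .
    fix l :: 'v assume "norm l \<le> R"
    then show "mgf (S n) l \<le> exp (\<bar>B\<bar> * v n)"
      using mgf_le_exp_norm[OF exp_moments[OF n]] * by (meson order_trans)
  qed simp
qed

lemma c_le:
  assumes k: "k > r" and b: "b \<ge> 0" "\<And>n. n \<ge> 1 \<Longrightarrow> mgf (S n) l \<le> exp (b * v n)"
  shows "c k l \<le> b"
proof -
  have kr: "k - r \<ge> 1" using k by simp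
  have "ln (mgf (S (k - r)) l) \<le> ln (exp (b * v (k - r)))"
    using b(2)[OF kr] mgf_pos[OF exp_moments[OF kr]] by (intro ln_mono) auto
  also have "\<dots> \<le> b * v k" using b(1) v_mono by (simp add: mult_left_mono monoD)
  finally show ?thesis unfolding c_def using v_pos[of k] k by (simp add: field_simps)
qed

text \<open>The comparison of moment generating functions is applied in both directions. The
  approximant inherits the growth rate \<open>b\<close> from \<open>c_le\<close> and
  \<open>w n \<le> v n\<close>. Since \<open>C0\<close> is found before \<open>k\<close>,
  \<open>Y\<close> and \<open>w\<close>, these can be taken for a sufficiently large
  \<open>C\<close>.\<close>

lemma eventually_ln_mgf_close:
  assumes e: "e > 0" and R: "R > 0"
  obtains C0 where "C0 > 0"
    "\<And>k Y w C. k > r \<Longrightarrow> C \<ge> C0 \<Longrightarrow> approximant k e C Y w \<Longrightarrow>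
      eventually (\<lambda>n. \<forall>l. norm l \<le> R \<longrightarrow>
        \<bar>ln (mgf (S n) l) - w n * c k l\<bar> \<le> norm l * e * v n + ln 2) sequentially"
proof -
  \<comment> \<open>The radius is doubled because the comparison uses the moment at
    \<open>2 *\<^sub>R l\<close>.\<close>
  obtain b where b: "b \<ge> 0" "\<And>n l. n \<ge> 1 \<Longrightarrow> norm l \<le> 2 * R \<Longrightarrow> mgf (S n) l \<le> exp (b * v n)"
    using mgf_bound[of "2 * R"] R by (metis less_imp_le mult_nonneg_nonneg zero_le_numeral)
  show thesis
  proof (rule that[of "3 * b + 4"])
    show "3 * b + 4 > 0" using b by simp
    fix k Y w C assume k: "k > r" and C: "C \<ge> 3 * b + 4" and A: "approximant k e C Y w"
    have Y: "has_exp_moments (Y n)" "mgf (Y n) l = exp (w n * c k l)" for n l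
      using A by (auto simp: approximant_def)
    have "eventually (\<lambda>n. 0 < w n \<and> w n \<le> v n) sequentially"
      "eventually (\<lambda>n. prob {\<omega> \<in> space M. norm (S n \<omega> - Y n \<omega>) > e * v n} \<le> exp (- C * v n)) sequentially"
      using A by (auto simp: approximant_def)
    with eventually_ge_at_top[of 1]
    show "eventually (\<lambda>n. \<forall>l. norm l \<le> R \<longrightarrow>
        \<bar>ln (mgf (S n) l) - w n * c k l\<bar> \<le> norm l * e * v n + ln 2) sequentially"
    proof eventually_elim
      case (elim n)
      have n: "n \<ge> 1" using elim by simp
      note X = exp_moments[OF n]
      have close: "prob {\<omega> \<in> space M. norm (S n \<omega> - Y n \<omega>) > e * v n} \<le> exp (- C * v n)" using elim by simp
      then have close': "prob {\<omega> \<in> space M. norm (Y n \<omega> - S n \<omega>) > e * v n} \<le> exp (- C * v n)"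
        by (simp only: norm_minus_commute)
      have bY: "mgf (Y n) l \<le> exp (b * v n)" if "norm l \<le> 2 * R" for l
      proof -
        have "w n * c k l \<le> w n * b" using elim c_le[OF k b(1) b(2)] that by (intro mult_left_mono) auto
        also have "\<dots> \<le> b * v n" using elim b(1) by (metis mult.commute mult_left_mono)
        finally show ?thesis using Y by simp
      qed
      show ?case
      proof (intro allI impI)
        fix l :: 'v assume l: "norm l \<le> R"
        have 1: "mgf (S n) l \<le> 2 * exp (norm l * e * v n) * mgf (Y n) l"
          using b(2)[OF n] l R C e v_ge_1[OF n] by (intro mgf_le_of_exp_close[OF X Y(1) _ _ close, where b=b]) auto
        have 2: "mgf (Y n) l \<le> 2 * exp (norm l * e * v n) * mgf (S n) l"
          using bY l R C e v_ge_1[OF n] by (intro mgf_le_of_exp_close[OF Y(1) X _ _ close', where b=b]) auto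
        have "ln (mgf (S n) l) \<le> ln (2 * exp (norm l * e * v n) * mgf (Y n) l)"
          using 1 mgf_pos[OF X] by (intro ln_mono) auto
        also have "\<dots> = ln 2 + norm l * e * v n + w n * c k l"
          using Y(2) by (simp add: ln_mult)
        finally have 3: "ln (mgf (S n) l) \<le> ln 2 + norm l * e * v n + w n * c k l" .
        have "ln (mgf (Y n) l) \<le> ln (2 * exp (norm l * e * v n) * mgf (S n) l)"
          using 2 mgf_pos[OF Y(1)] by (intro ln_mono) auto
        also have "\<dots> = ln 2 + norm l * e * v n + ln (mgf (S n) l)"
          using mgf_pos[OF X, of l] by (simp add: ln_mult)
        finally have 4: "w n * c k l \<le> ln 2 + norm l * e * v n + ln (mgf (S n) l)" using Y(2) by simp
        show "\<bar>ln (mgf (S n) l) - w n * c k l\<bar> \<le> norm l * e * v n + ln 2"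
          using 3 4 by (simp add: abs_le_iff)
      qed
    qed
  qed
qed

definition scaled_log_mgf :: "nat \<Rightarrow> 'v \<Rightarrow> real" where
  "scaled_log_mgf n l = ln (mgf (S n) l) / v n"

lemma scaled_log_mgf_near:
  assumes e: "e > 0" and R: "R > 0"
  obtains K where "K > r" "\<And>k l. k \<ge> K \<Longrightarrow> norm l \<le> R \<Longrightarrow>
      \<exists>q. eventually (\<lambda>n. \<bar>scaled_log_mgf n l - c k l\<bar> \<le> q n) sequentially \<and> q \<longlonglongrightarrow> e * norm l"
proof -
  obtain C0 where C0: "C0 > 0"
    "\<And>k Y w C. k > r \<Longrightarrow> C \<ge> C0 \<Longrightarrow> approximant k e C Y w \<Longrightarrow>
      eventually (\<lambda>n. \<forall>l. norm l \<le> R \<longrightarrow>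
        \<bar>ln (mgf (S n) l) - w n * c k l\<bar> \<le> norm l * e * v n + ln 2) sequentially"
    using eventually_ln_mgf_close[OF e R] by blast
  obtain K where K: "K > r" "\<forall>k\<ge>K. \<exists>Y w. approximant k e C0 Y w"
    using ex_approximant[OF e C0(1)] by blast
  show thesis
  proof (rule that[OF K(1)])
    fix k l assume k: "k \<ge> K" and l: "norm (l::'v) \<le> R"
    obtain Y w where A: "approximant k e C0 Y w" using K k by blast
    have w: "(\<lambda>n. w n / v n) \<longlonglongrightarrow> 1" using A by (auto simp: approximant_def)
    \<comment> \<open>The last term pays for replacing \<open>w n / v n\<close> by 1. Like the
      \<open>ln 2\<close> term it tends to 0, so that only the error proportional to
      \<open>norm l\<close> survives.\<close>
    define q where "q n = norm l * e + ln 2 / v n + \<bar>w n / v n - 1\<bar> * \<bar>c k l\<bar>" for n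
    have "q \<longlonglongrightarrow> norm l * e + 0 + \<bar>1 - 1\<bar> * \<bar>c k l\<bar>"
      unfolding q_def by (intro tendsto_intros inverse_v_tendsto w)
    then have lim: "q \<longlonglongrightarrow> e * norm l" by (simp add: mult.commute)
    have "eventually (\<lambda>n. \<forall>l. norm l \<le> R \<longrightarrow>
        \<bar>ln (mgf (S n) l) - w n * c k l\<bar> \<le> norm l * e * v n + ln 2) sequentially"
      using C0(2)[OF _ _ A] K k by simp
    with eventually_ge_at_top[of 1]
    have "eventually (\<lambda>n. \<bar>scaled_log_mgf n l - c k l\<bar> \<le> q n) sequentially"
    proof eventually_elim
      case (elim n)
      have v: "v n > 0" using v_pos elim by blast
      have "\<bar>scaled_log_mgf n l - w n / v n * c k l\<bar> = \<bar>ln (mgf (S n) l) - w n * c k l\<bar> / v n"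
        using v by (simp add: scaled_log_mgf_def diff_divide_distrib[symmetric])
      also have "\<dots> \<le> (norm l * e * v n + ln 2) / v n"
        using elim l v by (intro divide_right_mono) auto
      also have "\<dots> = norm l * e + ln 2 / v n" using v by (simp add: field_simps)
      finally have 1: "\<bar>scaled_log_mgf n l - w n / v n * c k l\<bar> \<le> norm l * e + ln 2 / v n" .
      have 2: "\<bar>w n / v n * c k l - c k l\<bar> = \<bar>w n / v n - 1\<bar> * \<bar>c k l\<bar>"
        by (simp add: algebra_simps flip: abs_mult)
      show ?case unfolding q_def using 1 2 by linarith
    qed
    with lim show "\<exists>q. eventually (\<lambda>n. \<bar>scaled_log_mgf n l - c k l\<bar> \<le> q n) sequentially \<and> q \<longlonglongrightarrow> e * norm l"
      by blast
  qed
qed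

definition \<phi> :: "'v \<Rightarrow> real" where
  "\<phi> l = lim (\<lambda>n. scaled_log_mgf n l)"

lemma scaled_log_mgf_tendsto: "(\<lambda>n. scaled_log_mgf n l) \<longlonglongrightarrow> \<phi> l"
proof -
  have "convergent (\<lambda>n. scaled_log_mgf n l)"
  proof (rule convergent_if_eventually_near)
    fix \<delta> :: real assume \<delta>: "\<delta> > 0"
    define e where "e = \<delta> / (2 * (norm l + 1))"
    have e: "e > 0" using \<delta> by (simp add: e_def add_nonneg_pos)
    have "e * norm l \<le> e * (norm l + 1)" using e by simp
    also have "\<dots> = \<delta> / 2" unfolding e_def using norm_ge_zero[of l] by (simp add: field_simps add_nonneg_eq_0_iff)
    finally have el: "e * norm l < \<delta>" using \<delta> by simp
    obtain K where K: "K > r" "\<And>k l'. k \<ge> K \<Longrightarrow> norm l' \<le> norm l + 1 \<Longrightarrow>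
      \<exists>q. eventually (\<lambda>n. \<bar>scaled_log_mgf n l' - c k l'\<bar> \<le> q n) sequentially \<and> q \<longlonglongrightarrow> e * norm l'"
      using scaled_log_mgf_near[OF e add_nonneg_pos[OF norm_ge_zero[of l] zero_less_one]] by blast
    obtain q where q: "eventually (\<lambda>n. \<bar>scaled_log_mgf n l - c K l\<bar> \<le> q n) sequentially" "q \<longlonglongrightarrow> e * norm l"
      using K(2)[of K l] by auto
    from order_tendstoD(2)[OF q(2) el] q(1)
    have "eventually (\<lambda>n. dist (scaled_log_mgf n l) (c K l) \<le> \<delta>) sequentially"
      by eventually_elim (auto simp: dist_real_def)
    then show "\<exists>x. eventually (\<lambda>n. dist (scaled_log_mgf n l) x \<le> \<delta>) sequentially" by blast
  qed
  then show ?thesis unfolding \<phi>_def by (simp add: convergent_LIMSEQ_iff)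
qed

lemma \<phi>_near_c:
  assumes e: "e > 0" and R: "R > 0"
  obtains K where "K > r" "\<And>k l. k \<ge> K \<Longrightarrow> norm l \<le> R \<Longrightarrow> \<bar>\<phi> l - c k l\<bar> \<le> e * norm l"
proof -
  obtain K where K: "K > r" "\<And>k l. k \<ge> K \<Longrightarrow> norm l \<le> R \<Longrightarrow>
      \<exists>q. eventually (\<lambda>n. \<bar>scaled_log_mgf n l - c k l\<bar> \<le> q n) sequentially \<and> q \<longlonglongrightarrow> e * norm l"
    using scaled_log_mgf_near[OF e R] by blast
  show thesis
  proof (rule that[OF K(1)])
    fix k l assume "k \<ge> K" "norm (l::'v) \<le> R"
    then obtain q where q: "eventually (\<lambda>n. \<bar>scaled_log_mgf n l - c k l\<bar> \<le> q n) sequentially" "q \<longlonglongrightarrow> e * norm l"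
      using K by blast
    have "(\<lambda>n. \<bar>scaled_log_mgf n l - c k l\<bar>) \<longlonglongrightarrow> \<bar>\<phi> l - c k l\<bar>"
      by (intro tendsto_intros scaled_log_mgf_tendsto)
    then show "\<bar>\<phi> l - c k l\<bar> \<le> e * norm l"
      using q by (intro tendsto_le[OF _ q(2)]) auto
  qed
qed

lemma \<phi>_zero [simp]: "\<phi> 0 = 0"
  using scaled_log_mgf_tendsto[of 0] by (simp add: scaled_log_mgf_def LIMSEQ_const_iff)

text \<open>Needed for coercivity: it makes the Fenchel transform grow at least like the
  norm.\<close>

lemma \<phi>_bound:
  obtains b where "\<And>l. norm l \<le> 1 \<Longrightarrow> \<phi> l \<le> b"
proof -
  obtain b where b: "b \<ge> 0" "\<And>n l. n \<ge> 1 \<Longrightarrow> norm l \<le> 1 \<Longrightarrow> mgf (S n) l \<le> exp (b * v n)"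
    using mgf_bound[of 1] by (metis zero_le_one)
  show thesis
  proof (rule that)
    fix l :: 'v assume l: "norm l \<le> 1"
    have "eventually (\<lambda>n. scaled_log_mgf n l \<le> b) sequentially"
      using eventually_ge_at_top[of 1]
    proof eventually_elim
      case (elim n)
      have "ln (mgf (S n) l) \<le> ln (exp (b * v n))"
        using b(2)[OF elim l] mgf_pos[OF exp_moments[OF elim]] by (intro ln_mono) auto
      then show ?case using v_pos[OF elim] by (simp add: scaled_log_mgf_def field_simps)
    qed
    then show "\<phi> l \<le> b" by (rule tendsto_upperbound[OF scaled_log_mgf_tendsto]) simp
  qed
qed

section \<open>Gradients at 0 and convergence of the scaled means\<close>

text \<open>The gradient of \<open>c k\<close> at 0; it carries the same normalisation
  \<open>v k\<close>.\<close>

definition g :: "nat \<Rightarrow> 'v" where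
  "g k = (1 / v k) *\<^sub>R expectation (S (k - r))"

lemma inner_g_le_c:
  assumes "k > r"
  shows "u \<bullet> g k \<le> c k u"
proof -
  have "u \<bullet> expectation (S (k - r)) / v k \<le> ln (mgf (S (k - r)) u) / v k"
    using inner_expectation_le_ln_mgf[OF exp_moments, of "k - r" u] v_pos[of k] assms
    by (intro divide_right_mono) auto
  then show ?thesis by (simp add: g_def c_def)
qed

lemma c_le_quadratic:
  assumes k: "k > r"
  obtains m K where "K \<ge> 0" "\<And>u. norm u \<le> 1 \<Longrightarrow> c k (l + u) \<le> c k l + u \<bullet> m + K * (norm u)\<^sup>2"
    "l = 0 \<Longrightarrow> m = g k"
proof -
  have X: "has_exp_moments (S (k - r))" using exp_moments[of "k - r"] k by simp
  have v: "v k > 0" using v_pos[of k] k by simp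
  obtain m K where mK: "K \<ge> 0" "\<And>u. norm u \<le> 1 \<Longrightarrow> ln (mgf (S (k - r)) (l + u)) \<le> ln (mgf (S (k - r)) l) + u \<bullet> m + K * (norm u)\<^sup>2"
    "l = 0 \<Longrightarrow> m = expectation (S (k - r))"
    using ln_mgf_le_quadratic[OF X, of l] by blast
  show thesis
  proof (rule that[of "K / v k" "(1 / v k) *\<^sub>R m"])
    show "K / v k \<ge> 0" using mK v by simp
    show "l = 0 \<Longrightarrow> (1 / v k) *\<^sub>R m = g k" using mK by (simp add: g_def)
    fix u :: 'v assume "norm u \<le> 1"
    then have "ln (mgf (S (k - r)) (l + u)) / v k \<le> (ln (mgf (S (k - r)) l) + u \<bullet> m + K * (norm u)\<^sup>2) / v k"
      using mK(2) v by (intro divide_right_mono) auto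
    then show "c k (l + u) \<le> c k l + u \<bullet> ((1 / v k) *\<^sub>R m) + K / v k * (norm u)\<^sup>2"
      by (simp add: c_def add_divide_distrib)
  qed
qed

lemma isCont_c:
  assumes k: "k > r"
  shows "isCont (c k) l"
proof -
  have X: "has_exp_moments (S (k - r))" using exp_moments[of "k - r"] k by simp
  have "mgf (S (k - r)) l \<noteq> 0" "v k \<noteq> 0" using mgf_pos[OF X, of l] v_pos[of k] k by auto
  then show ?thesis unfolding c_def by (intro continuous_intros isCont_mgf X)
qed

lemma c_zero [simp]: "c k 0 = 0"
  by (simp add: c_def)

text \<open>As \<open>c k\<close> is differentiable at \<open>0\<close> with gradient \<open>g k\<close> and \<open>\<bar>\<phi> u - c k u\<bar> \<le> e * norm u\<close>, every
  subgradient of \<open>\<phi>\<close> at \<open>0\<close> lies within \<open>e\<close> of \<open>g k\<close>.\<close>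

lemma subgradient_near_g:
  assumes e: "e > 0"
  obtains K where "K > r"
    "\<And>k x \<delta>. k \<ge> K \<Longrightarrow> \<delta> \<ge> 0 \<Longrightarrow> (\<And>u. norm u \<le> 1 \<Longrightarrow> u \<bullet> x \<le> \<phi> u + \<delta> * norm u) \<Longrightarrow> norm (x - g k) \<le> e + \<delta>"
proof -
  obtain K where K: "K > r" "\<And>k l. k \<ge> K \<Longrightarrow> norm l \<le> 1 \<Longrightarrow> \<bar>\<phi> l - c k l\<bar> \<le> e * norm l"
    using \<phi>_near_c[OF e, of 1] by auto
  show thesis
  proof (rule that[OF K(1)])
    fix k x \<delta> assume k: "k \<ge> K" and \<delta>: "\<delta> \<ge> 0" and x: "\<And>u. norm u \<le> 1 \<Longrightarrow> u \<bullet> x \<le> \<phi> u + \<delta> * norm u"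
    have kr: "k > r" using k K by simp
    obtain A where A: "A \<ge> 0" "\<And>u. norm u \<le> 1 \<Longrightarrow> c k (0 + u) \<le> c k 0 + u \<bullet> g k + A * (norm u)\<^sup>2"
      using c_le_quadratic[OF kr, of 0] by metis
    show "norm (x - g k) \<le> e + \<delta>"
    proof (rule norm_le_of_inner_le_quadratic[where \<rho>=1 and K=A])
      fix u :: 'v assume u: "norm u \<le> 1"
      show "u \<bullet> (x - g k) \<le> (e + \<delta>) * norm u + A * (norm u)\<^sup>2"
        using x[OF u] K(2)[OF k u] A(2)[OF u] by (simp add: algebra_simps abs_le_iff)
    qed (use e \<delta> in auto)
  qed
qed

text \<open>\<open>g K1\<close> is a subgradient of \<open>c K1\<close> at 0, hence one of
  \<open>\<phi>\<close> up to the slack \<open>\<delta> / 2 * norm u\<close>. Every late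
  \<open>g k\<close> is therefore close to it. This is the use of the slack in
  \<open>subgradient_near_g\<close>.\<close>

lemma convergent_g: "convergent g"
proof (rule convergent_if_eventually_near)
  fix \<delta> :: real assume "\<delta> > 0"
  then have e: "\<delta> / 2 > 0" by simp
  obtain K1 where K1: "K1 > r" "\<And>k l. k \<ge> K1 \<Longrightarrow> norm l \<le> 1 \<Longrightarrow> \<bar>\<phi> l - c k l\<bar> \<le> \<delta> / 2 * norm l"
    using \<phi>_near_c[OF e, of 1] by auto
  obtain K2 where K2: "K2 > r"
    "\<And>k x \<eta>. k \<ge> K2 \<Longrightarrow> \<eta> \<ge> 0 \<Longrightarrow> (\<And>u. norm u \<le> 1 \<Longrightarrow> u \<bullet> x \<le> \<phi> u + \<eta> * norm u) \<Longrightarrow> norm (x - g k) \<le> \<delta> / 2 + \<eta>"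
    using subgradient_near_g[OF e] by blast
  have "dist (g k) (g K1) \<le> \<delta>" if k: "k \<ge> K2" for k
  proof -
    have "norm (g K1 - g k) \<le> \<delta> / 2 + \<delta> / 2"
    proof (rule K2(2)[OF k])
      fix u :: 'v assume "norm u \<le> 1"
      then show "u \<bullet> g K1 \<le> \<phi> u + \<delta> / 2 * norm u"
        using K1(2)[of K1 u, OF order_refl] inner_g_le_c[OF K1(1), of u] by linarith
    qed (use e in simp)
    then show ?thesis by (simp add: dist_norm norm_minus_commute)
  qed
  then show "\<exists>x. eventually (\<lambda>n. dist (g n) x \<le> \<delta>) sequentially"
    by (auto simp: eventually_sequentially)
qed

lemma g_tendsto: "g \<longlonglongrightarrow> lim g"
  using convergent_g by (simp add: convergent_LIMSEQ_iff)

text \<open>\<open>g (n + r)\<close> is the mean of \<open>S n\<close> divided by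
  \<open>v (n + r)\<close>; the ratio of the two volumes tends to 1.\<close>

lemma mean_tendsto: "(\<lambda>n. (1 / v n) *\<^sub>R expectation (S n)) \<longlonglongrightarrow> lim g"
proof -
  have "(\<lambda>n. (v (n + r) / v n) *\<^sub>R g (n + r)) \<longlonglongrightarrow> 1 *\<^sub>R lim g"
    using g_tendsto by (intro tendsto_intros v_shift LIMSEQ_ignore_initial_segment)
  moreover have "eventually (\<lambda>n. (v (n + r) / v n) *\<^sub>R g (n + r) = (1 / v n) *\<^sub>R expectation (S n)) sequentially"
    using eventually_ge_at_top[of 1]
  proof eventually_elim
    case (elim n)
    then show ?case using v_pos[of "n + r"] by (simp add: g_def)
  qed
  ultimately show ?thesis by (simp add: tendsto_cong)
qed

text \<open>The inequality \<open>u \<bullet> g k \<le> c k u\<close> passes to the limit in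
  \<open>k\<close> with an error \<open>e * norm u\<close>, and then \<open>e\<close> tends to 0.
  Thus \<open>lim g\<close> is a subgradient of \<open>\<phi>\<close> at 0.\<close>

lemma inner_lim_g_le_\<phi>: "u \<bullet> lim g \<le> \<phi> u"
proof -
  have "u \<bullet> lim g \<le> \<phi> u + e * norm u" if e: "e > 0" for e
  proof -
    obtain K where K: "K > r" "\<And>k l. k \<ge> K \<Longrightarrow> norm l \<le> norm u + 1 \<Longrightarrow> \<bar>\<phi> l - c k l\<bar> \<le> e * norm l"
      using \<phi>_near_c[OF e add_nonneg_pos[OF norm_ge_zero[of u] zero_less_one]] by blast
    have "eventually (\<lambda>k. u \<bullet> g k \<le> \<phi> u + e * norm u) sequentially"
      using eventually_ge_at_top[of K]
    proof eventually_elim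
      case (elim k)
      show ?case using K(1) K(2)[OF elim, of u] inner_g_le_c[of k u] elim by (simp add: abs_le_iff)
    qed
    moreover have "(\<lambda>k. u \<bullet> g k) \<longlonglongrightarrow> u \<bullet> lim g" by (intro tendsto_intros g_tendsto)
    ultimately show ?thesis by (intro tendsto_upperbound) auto
  qed
  moreover have "((\<lambda>e. \<phi> u + e * norm u) \<longlongrightarrow> \<phi> u + 0 * norm u) (at_right 0)" by (intro tendsto_intros)
  ultimately have "u \<bullet> lim g \<le> \<phi> u + 0 * norm u"
    by (intro tendsto_lowerbound[where F="at_right 0"]) (auto simp: eventually_at_right_less elim!: eventually_mono[rotated] intro!: eventually_at_rightI[of 0 1])
  then show ?thesis by simp
qed

section \<open>Zeros, compact level sets and convexity of the Fenchel transform\<close>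

lemma fenchel_nonneg: "0 \<le> fenchel \<phi> x"
proof -
  have "ereal (0 \<bullet> x - \<phi> 0) \<le> fenchel \<phi> x" unfolding fenchel_def by (rule SUP_upper) simp
  then show ?thesis by (simp add: zero_ereal_def)
qed

lemma fenchel_le_iff: "fenchel \<phi> x \<le> ereal a \<longleftrightarrow> (\<forall>l. l \<bullet> x - \<phi> l \<le> a)"
  by (simp add: fenchel_def SUP_le_iff)

text \<open>As the transform is nonnegative, it vanishes at \<open>x\<close> exactly when
  \<open>u \<bullet> x \<le> \<phi> u\<close> for all \<open>u\<close>, that is, when
  \<open>x\<close> is a subgradient at 0. With slack 0 any such \<open>x\<close> is the limit of
  \<open>g\<close>.\<close>

lemma fenchel_eq_0_iff: "fenchel \<phi> x = 0 \<longleftrightarrow> x = lim g"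
proof
  assume "x = lim g"
  then have "fenchel \<phi> x \<le> ereal 0" unfolding fenchel_le_iff using inner_lim_g_le_\<phi> by simp
  then show "fenchel \<phi> x = 0" using fenchel_nonneg[of x] by (simp add: zero_ereal_def)
next
  assume "fenchel \<phi> x = 0"
  then have "fenchel \<phi> x \<le> ereal 0" by (simp add: zero_ereal_def)
  then have x: "u \<bullet> x \<le> \<phi> u" for u unfolding fenchel_le_iff by simp
  have "g \<longlonglongrightarrow> x"
  proof (rule metric_LIMSEQ_I)
    fix \<delta> :: real assume "\<delta> > 0"
    then have e: "\<delta> / 2 > 0" by simp
    obtain K where K: "K > r" "\<And>k x \<eta>. k \<ge> K \<Longrightarrow> \<eta> \<ge> 0 \<Longrightarrow> (\<And>u. norm u \<le> 1 \<Longrightarrow> u \<bullet> x \<le> \<phi> u + \<eta> * norm u) \<Longrightarrow> norm (x - g k) \<le> \<delta> / 2 + \<eta>"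
      using subgradient_near_g[OF e] by blast
    have "dist (g k) x < \<delta>" if "k \<ge> K" for k
      using K(2)[OF that, of 0 x] x \<open>\<delta> > 0\<close> by (simp add: dist_norm norm_minus_commute)
    then show "\<exists>K. \<forall>k\<ge>K. dist (g k) x < \<delta>" by blast
  qed
  then show "x = lim g" using g_tendsto LIMSEQ_unique by blast
qed

lemma good_rate_function_fenchel: "good_rate_function (fenchel \<phi>)"
proof -
  have cl: "closed {x. fenchel \<phi> x \<le> ereal a}" for a
  proof -
    have "{x. fenchel \<phi> x \<le> ereal a} = (\<Inter>l. {x. l \<bullet> x \<le> a + \<phi> l})"
      by (auto simp: fenchel_le_iff algebra_simps)
    then show ?thesis by (simp add: closed_INT closed_halfspace_le)
  qed
  obtain b where b: "\<And>l. norm l \<le> 1 \<Longrightarrow> \<phi> l \<le> b" using \<phi>_bound by blast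
  have bd: "bounded {x. fenchel \<phi> x \<le> ereal a}" for a
  proof (rule boundedI)
    fix x assume "x \<in> {x. fenchel \<phi> x \<le> ereal a}"
    \<comment> \<open>The test vector \<open>sgn x\<close> is the unit vector along
      \<open>x\<close>, or 0 if \<open>x = 0\<close>; in either case its inner product with
      \<open>x\<close> is \<open>norm x\<close>.\<close>
    then have "sgn x \<bullet> x - \<phi> (sgn x) \<le> a" by (simp add: fenchel_le_iff)
    moreover have "sgn x \<bullet> x = norm x"
      by (cases "x = 0") (simp_all add: sgn_div_norm dot_square_norm power2_eq_square)
    moreover have "\<phi> (sgn x) \<le> b" by (rule b) (simp add: norm_sgn)
    ultimately show "norm x \<le> a + b" by simp
  qed
  show ?thesis unfolding good_rate_function_def rate_function_def
    using fenchel_nonneg cl bd by (simp add: compact_eq_bounded_closed)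
qed

lemma convex_efun_fenchel: "convex_efun (fenchel \<phi>)"
  unfolding convex_efun_def
proof (intro allI impI)
  fix x y :: 'v and t :: real assume t: "0 < t \<and> t < 1"
  have up: "ereal (l \<bullet> x - \<phi> l) \<le> fenchel \<phi> x" for l x unfolding fenchel_def by (rule SUP_upper) simp
  show "fenchel \<phi> (t *\<^sub>R x + (1 - t) *\<^sub>R y) \<le> ereal t * fenchel \<phi> x + ereal (1 - t) * fenchel \<phi> y"
  proof (subst (1) fenchel_def, rule SUP_least)
    fix l
    have "ereal (l \<bullet> (t *\<^sub>R x + (1 - t) *\<^sub>R y) - \<phi> l)
      = ereal t * ereal (l \<bullet> x - \<phi> l) + ereal (1 - t) * ereal (l \<bullet> y - \<phi> l)"
      by (simp add: algebra_simps)
    also have "\<dots> \<le> ereal t * fenchel \<phi> x + ereal (1 - t) * fenchel \<phi> y"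
      using t by (intro add_mono ereal_mult_left_mono up) auto
    finally show "ereal (l \<bullet> (t *\<^sub>R x + (1 - t) *\<^sub>R y) - \<phi> l)
      \<le> ereal t * fenchel \<phi> x + ereal (1 - t) * fenchel \<phi> y" .
  qed
qed

end

section \<open>Large deviation bounds\<close>

lemma ln_le_iff_le_exp: "0 < x \<Longrightarrow> ln x \<le> t \<longleftrightarrow> x \<le> exp t" for x t :: real
  by (metis exp_le_cancel_iff exp_ln)

context mgf_approx
begin

text \<open>The union bound is a single pointwise estimate: the indicator of the event is dominated
  by one exponential for each half-space of a finite cover of
  \<open>F \<inter> cball 0 \<rho>\<close>, plus one for the exterior of the ball. The latter makes
  compactness available for unbounded \<open>F\<close>.\<close>

lemma prob_closed_le:
  assumes F: "closed F" and \<alpha>: "\<And>x. x \<in> F \<Longrightarrow> ereal \<alpha> < fenchel \<phi> x" and e: "e > 0"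
  shows "eventually (\<lambda>n. prob {\<omega> \<in> space M. (1 / v n) *\<^sub>R S n \<omega> \<in> F} \<le> exp (v n * (e - \<alpha>))) sequentially"
proof -
  obtain b where b: "b \<ge> 0" "\<And>n. n \<ge> 1 \<Longrightarrow> expectation (\<lambda>\<omega>. exp (1 * norm (S n \<omega>))) \<le> exp (b * v n)"
    using mgf_bound[of 1] by (metis zero_le_one)
  \<comment> \<open>Markov's inequality outside this ball gives
    \<open>exp (- \<rho> * v n) * exp (b * v n)\<close>, which is
    \<open>exp (- \<bar>\<alpha>\<bar> * v n)\<close> and so at most
    \<open>exp (- \<alpha> * v n)\<close>.\<close>
  define \<rho> where "\<rho> = b + \<bar>\<alpha>\<bar>"
  define U where "U l = {y. \<alpha> + \<phi> l < l \<bullet> y}" for l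
  have "F \<inter> cball 0 \<rho> \<subseteq> (\<Union>l\<in>UNIV. U l)"
  proof
    fix x assume "x \<in> F \<inter> cball 0 \<rho>"
    then have "ereal \<alpha> < fenchel \<phi> x" using \<alpha> by simp
    then obtain l where "ereal \<alpha> < ereal (l \<bullet> x - \<phi> l)" unfolding fenchel_def less_SUP_iff by auto
    then show "x \<in> (\<Union>l\<in>UNIV. U l)" by (auto simp: U_def algebra_simps)
  qed
  moreover have "compact (F \<inter> cball 0 \<rho>)" using F by (intro closed_Int_compact) auto
  moreover have "open (U l)" for l unfolding U_def by (simp add: open_halfspace_gt)
  ultimately obtain L where L: "finite L" "F \<inter> cball 0 \<rho> \<subseteq> (\<Union>l\<in>L. U l)"
    by (metis compactE_image)
  \<comment> \<open>The number of half-spaces, plus one for the exterior. One half of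
    \<open>e\<close> absorbs this factor once \<open>v n \<ge> 2 * ln N / e\<close>; the other half
    covers the convergence of the logarithmic moment generating functions.\<close>
  define N where "N = real (card L) + 1"
  have N: "N \<ge> 1" by (simp add: N_def)
  have "eventually (\<lambda>n. \<forall>l\<in>L. scaled_log_mgf n l < \<phi> l + e / 2) sequentially"
    using L(1) e by (intro eventually_ball_finite ballI order_tendstoD[OF scaled_log_mgf_tendsto]) auto
  with eventually_ge_at_top[of 1] eventually_v_ge[of "2 * ln N / e"]
  show ?thesis
  proof eventually_elim
    case (elim n)
    have n: "n \<ge> 1" using elim by simp
    have v: "v n > 0" using v_pos[OF n] .
    note X = exp_moments[OF n]
    have [measurable]: "S n \<in> borel_measurable M" using has_exp_momentsD(1)[OF X] .
    have [measurable]: "F \<in> sets borel" using F by (rule borel_closed)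
    define A where "A = {\<omega> \<in> space M. (1 / v n) *\<^sub>R S n \<omega> \<in> F}"
    have A[measurable]: "A \<in> events" unfolding A_def by measurable
    have intN: "integrable M (\<lambda>\<omega>. exp (1 * norm (S n \<omega>)))" using integrable_exp_norm[OF X, of 1] by simp
    have "prob A = expectation (indicator A)" using A by simp
    also have "\<dots> \<le> expectation (\<lambda>\<omega>. (\<Sum>l\<in>L. exp (- v n * (\<alpha> + \<phi> l)) * exp (l \<bullet> S n \<omega>))
        + exp (- \<rho> * v n) * exp (1 * norm (S n \<omega>)))"
    proof (intro integral_mono Bochner_Integration.integrable_add Bochner_Integration.integrable_sum
        integrable_mult_right has_exp_momentsD[OF X] intN)
      show "integrable M (indicator A :: 'a \<Rightarrow> real)"
        by (intro integrable_real_indicator) (auto simp: emeasure_eq_measure)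
      fix \<omega> assume "\<omega> \<in> space M"
      let ?s = "\<Sum>l\<in>L. exp (- v n * (\<alpha> + \<phi> l)) * exp (l \<bullet> S n \<omega>)"
      have s0: "0 \<le> ?s" by (intro sum_nonneg) simp
      show "indicator A \<omega> \<le> ?s + exp (- \<rho> * v n) * exp (1 * norm (S n \<omega>))"
      proof (cases "\<omega> \<in> A")
        case True
        let ?y = "(1 / v n) *\<^sub>R S n \<omega>"
        have "1 \<le> ?s + exp (- \<rho> * v n) * exp (1 * norm (S n \<omega>))"
        proof (cases "norm ?y \<le> \<rho>")
          case True
          then have "?y \<in> F \<inter> cball 0 \<rho>" using \<open>\<omega> \<in> A\<close> by (auto simp: A_def)
          then obtain l where l: "l \<in> L" "\<alpha> + \<phi> l < l \<bullet> ?y" using L(2) by (auto simp: U_def)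
          then have "v n * (\<alpha> + \<phi> l) \<le> v n * (l \<bullet> ?y)" using v by (intro mult_left_mono) auto
          then have "v n * (\<alpha> + \<phi> l) \<le> l \<bullet> S n \<omega>" using v by simp
          then have "1 \<le> exp (- v n * (\<alpha> + \<phi> l)) * exp (l \<bullet> S n \<omega>)"
            unfolding exp_add[symmetric] by simp
          also have "\<dots> \<le> ?s" using l L(1) by (intro member_le_sum) auto
          finally show ?thesis by (simp add: add_increasing2)
        next
          case False
          then have "\<rho> * v n \<le> norm (S n \<omega>)" using v by (simp add: field_simps)
          then have "1 \<le> exp (- \<rho> * v n) * exp (1 * norm (S n \<omega>))"
            unfolding exp_add[symmetric] by simp
          then show ?thesis using s0 by linarith
        qed
        then show ?thesis using True by simp
      qed (use s0 in \<open>simp add: add_nonneg_nonneg\<close>)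
    qed
    also have "\<dots> = (\<Sum>l\<in>L. exp (- v n * (\<alpha> + \<phi> l)) * mgf (S n) l)
        + exp (- \<rho> * v n) * expectation (\<lambda>\<omega>. exp (1 * norm (S n \<omega>)))"
      unfolding mgf_def using has_exp_momentsD(2)[OF X] intN
      by (subst Bochner_Integration.integral_add) (auto intro!: Bochner_Integration.integrable_sum)
    also have "\<dots> \<le> (\<Sum>l\<in>L. exp (v n * (e / 2 - \<alpha>))) + exp (v n * (e / 2 - \<alpha>))"
    proof (intro add_mono sum_mono)
      fix l assume l: "l \<in> L"
      have "mgf (S n) l = exp (v n * scaled_log_mgf n l)"
        using v mgf_pos[OF X, of l] by (simp add: scaled_log_mgf_def)
      also have "\<dots> \<le> exp (v n * (\<phi> l + e / 2))"
        using elim l v by (subst exp_le_cancel_iff, intro mult_left_mono) (auto intro: less_imp_le)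
      finally have "exp (- v n * (\<alpha> + \<phi> l)) * mgf (S n) l \<le> exp (- v n * (\<alpha> + \<phi> l)) * exp (v n * (\<phi> l + e / 2))"
        by (intro mult_left_mono) auto
      also have "\<dots> = exp (v n * (e / 2 - \<alpha>))" unfolding exp_add[symmetric] by (simp add: algebra_simps)
      finally show "exp (- v n * (\<alpha> + \<phi> l)) * mgf (S n) l \<le> exp (v n * (e / 2 - \<alpha>))" .
    next
      have "exp (- \<rho> * v n) * expectation (\<lambda>\<omega>. exp (1 * norm (S n \<omega>))) \<le> exp (- \<rho> * v n) * exp (b * v n)"
        using b(2)[OF n] by (intro mult_left_mono) auto
      also have "\<dots> = exp (v n * (- \<bar>\<alpha>\<bar>))" unfolding exp_add[symmetric] \<rho>_def by (simp add: algebra_simps)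
      also have "\<dots> \<le> exp (v n * (e / 2 - \<alpha>))"
        using v e by (subst exp_le_cancel_iff, intro mult_left_mono) auto
      finally show "exp (- \<rho> * v n) * expectation (\<lambda>\<omega>. exp (1 * norm (S n \<omega>))) \<le> exp (v n * (e / 2 - \<alpha>))" .
    qed
    also have "\<dots> = N * exp (v n * (e / 2 - \<alpha>))" by (simp add: N_def algebra_simps)
    also have "\<dots> \<le> exp (v n * (e / 2)) * exp (v n * (e / 2 - \<alpha>))"
    proof (intro mult_right_mono)
      have "ln N \<le> v n * (e / 2)" using elim e by (simp add: field_simps)
      then show "N \<le> exp (v n * (e / 2))" using N by (subst (asm) ln_le_iff_le_exp) auto
    qed simp
    also have "\<dots> = exp (v n * (e - \<alpha>))" unfolding exp_add[symmetric] by (simp add: algebra_simps)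
    finally show ?case unfolding A_def .
  qed
qed

text \<open>At the maximiser of \<open>l \<bullet> x - c k l - \<theta> * (norm l)\<^sup>2\<close> over a large ball, the gradient of \<open>c k\<close> is a
  point near \<open>x\<close> whose cost under \<open>c k\<close> is at most slightly more than \<open>J\<close>. The quadratic penalty forces the
  maximiser into the interior although \<open>c k\<close> is close to \<open>\<phi>\<close> only on bounded sets.\<close>

lemma exposed_point_near:
  assumes J: "\<And>l. l \<bullet> x - \<phi> l \<le> J" and \<delta>: "\<delta> > 0" and e0: "e0 > 0"
  obtains K R where "K > r" "R > 0"
    "\<And>k. k \<ge> K \<Longrightarrow> \<exists>l y A. norm l \<le> R \<and> norm (y - x) \<le> \<delta> \<and> l \<bullet> y - c k l \<le> J + e0 \<and>
       (\<forall>u. norm u \<le> 1 \<longrightarrow> c k (l + u) \<le> c k l + u \<bullet> y + A * (norm u)\<^sup>2)"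
proof -
  have J0: "J \<ge> 0" using J[of 0] by simp
  \<comment> \<open>With \<open>s = \<theta> * norm l\<close>, comparing the maximiser with 0 gives
    \<open>s\<^sup>2 \<le> \<theta> * J + e * s\<close>. The bounds
    \<open>\<theta> * J \<le> (\<delta> / 4)\<^sup>2\<close> and \<open>e \<le> \<delta> / 4\<close>
    then force \<open>s \<le> \<delta> / 2\<close>, while the displacement of \<open>y\<close> from
    \<open>x\<close> is \<open>2 * s\<close>.\<close>
  define \<theta> where "\<theta> = (\<delta> / 4)\<^sup>2 / (J + 1)"
  have \<theta>: "\<theta> > 0" "\<theta> * J \<le> (\<delta> / 4)\<^sup>2"
  proof -
    show "\<theta> > 0" using J0 \<delta> by (simp add: \<theta>_def)
    have "\<theta> * J \<le> \<theta> * (J + 1)" using \<open>\<theta> > 0\<close> by simp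
    also have "\<dots> = (\<delta> / 4)\<^sup>2" using J0 by (simp add: \<theta>_def)
    finally show "\<theta> * J \<le> (\<delta> / 4)\<^sup>2" .
  qed
  \<comment> \<open>Large enough that \<open>\<theta> * R\<^sup>2 > J + R\<close>. As
    \<open>e \<le> 1\<close>, the penalised function is then negative on the sphere of radius
    \<open>R\<close>, whereas it is 0 at the centre.\<close>
  define R where "R = (J + 2) / \<theta> + 1"
  have R1: "R \<ge> 1" using J0 \<theta> by (simp add: R_def)
  have "\<theta> * R = J + 2 + \<theta>" using \<theta>(1) by (simp add: R_def field_simps)
  then have "\<theta> * R \<ge> J + 2" using \<theta> by simp
  then have "(\<theta> * R) * R \<ge> (J + 2) * R" using R1 by (intro mult_right_mono) auto
  moreover have "J * 1 \<le> J * R" using J0 R1 by (intro mult_left_mono) auto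
  ultimately have R2: "\<theta> * R\<^sup>2 > J + R" using R1 by (simp add: power2_eq_square algebra_simps)
  \<comment> \<open>The three caps serve the exclusion of the sphere, the distance from
    \<open>y\<close> to \<open>x\<close>, and the cost.\<close>
  define e where "e = min 1 (min (\<delta> / 4) (e0 / R))"
  have e: "e > 0" "e \<le> 1" "e \<le> \<delta> / 4" "e \<le> e0 / R"
    using \<delta> e0 R1 unfolding e_def by (auto simp del: le_divide_eq_numeral1)
  have eR: "e * R \<le> e0" using e(4) R1 by (simp add: field_simps)
  obtain K where K: "K > r" "\<And>k l. k \<ge> K \<Longrightarrow> norm l \<le> R \<Longrightarrow> \<bar>\<phi> l - c k l\<bar> \<le> e * norm l"
    using \<phi>_near_c[OF e(1), of R] R1 by (metis less_le_trans zero_less_one)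
  show thesis
  proof (rule that[OF K(1), of R])
    show "R > 0" using R1 by simp
    fix k assume k: "k \<ge> K"
    then have kr: "k > r" using K by simp
    define h where "h l = l \<bullet> x - c k l - \<theta> * (norm l)\<^sup>2" for l
    have h_le: "h l \<le> J + e * norm l - \<theta> * (norm l)\<^sup>2" if "norm l \<le> R" for l
      using J[of l] K(2)[OF k that] unfolding h_def by linarith
    have "continuous_on (cball 0 R) h" unfolding h_def
      using isCont_c[OF kr] by (intro continuous_intros continuous_at_imp_continuous_on) auto
    then obtain l where l: "l \<in> cball 0 R" "\<And>l'. l' \<in> cball 0 R \<Longrightarrow> h l' \<le> h l"
      using continuous_attains_sup[of "cball 0 R" h] R1 by auto
    have nl: "norm l \<le> R" using l by simp
    have h0: "0 \<le> h l" using l(2)[of 0] R1 by (simp add: h_def)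
    have "norm l \<noteq> R"
    proof
      assume eq: "norm l = R"
      have "e * R \<le> 1 * R" using e R1 by (intro mult_right_mono) auto
      then show False using h_le[OF nl] h0 R2 unfolding eq by linarith
    qed
    then have lt: "norm l < R" using nl by simp
    obtain m A where A: "A \<ge> 0" "\<And>u. norm u \<le> 1 \<Longrightarrow> c k (l + u) \<le> c k l + u \<bullet> m + A * (norm u)\<^sup>2"
      using c_le_quadratic[OF kr, of l] by metis
    \<comment> \<open>The gradient of \<open>l \<bullet> x - \<theta> * (norm l)\<^sup>2\<close>. At
      an interior maximiser it must equal the gradient \<open>m\<close> of \<open>c k\<close>:
      maximality bounds \<open>c k (l + u) - c k l\<close> from below with slope \<open>y\<close>,
      the quadratic estimate bounds it from above with slope \<open>m\<close>.\<close>
    define y where "y = x - (2 * \<theta>) *\<^sub>R l"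
    have "norm (y - m) \<le> 0"
    proof (rule norm_le_of_inner_le_quadratic[where \<rho>="min 1 (R - norm l)" and K="A + \<theta>"])
      fix u :: 'v assume u: "norm u \<le> min 1 (R - norm l)"
      have "norm (l + u) \<le> R" using norm_triangle_ineq[of l u] u by simp
      then have "h (l + u) \<le> h l" using l(2) by simp
      moreover have "(norm (l + u))\<^sup>2 = (norm l)\<^sup>2 + 2 * (l \<bullet> u) + (norm u)\<^sup>2"
        by (simp add: power2_norm_eq_inner inner_add_left inner_add_right inner_commute)
      ultimately have "u \<bullet> x - \<theta> * (2 * (l \<bullet> u) + (norm u)\<^sup>2) \<le> c k (l + u) - c k l"
        by (simp add: h_def algebra_simps)
      moreover have "u \<bullet> y = u \<bullet> x - \<theta> * (2 * (l \<bullet> u))"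
        by (simp add: y_def inner_diff_right inner_commute)
      ultimately show "u \<bullet> (y - m) \<le> 0 * norm u + (A + \<theta>) * (norm u)\<^sup>2"
        using A(2)[of u] u by (simp add: algebra_simps)
    qed (use lt in auto)
    then have ym: "m = y" by simp
    have cost: "l \<bullet> y - c k l \<le> J + e0"
    proof -
      have "l \<bullet> y - c k l = h l - \<theta> * (norm l)\<^sup>2"
        by (simp add: y_def h_def inner_diff_right power2_norm_eq_inner)
      also have "\<dots> \<le> h l" using \<theta> by simp
      also have "\<dots> \<le> J + e * norm l" using h_le[OF nl] \<theta> by (smt (verit) mult_nonneg_nonneg zero_le_power2)
      also have "e * norm l \<le> e * R" using nl e by (intro mult_left_mono) auto
      finally show ?thesis using eR by simp
    qed
    have near: "norm (y - x) \<le> \<delta>"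
    proof -
      define s where "s = \<theta> * norm l"
      have s0: "s \<ge> 0" using \<theta> by (simp add: s_def)
      have "\<theta> * (\<theta> * (norm l)\<^sup>2) \<le> \<theta> * (J + e * norm l)"
        using h0 h_le[OF nl] \<theta> by (intro mult_left_mono) auto
      then have "s\<^sup>2 \<le> \<theta> * J + e * s" by (simp add: s_def power2_eq_square algebra_simps)
      also have "\<dots> \<le> (\<delta> / 4)\<^sup>2 + \<delta> / 4 * s" using \<theta> e s0 by (intro add_mono mult_right_mono) auto
      finally have sq: "s\<^sup>2 \<le> (\<delta> / 4)\<^sup>2 + \<delta> / 4 * s" .
      have "s \<le> \<delta> / 2"
      proof (rule ccontr)
        assume "\<not> s \<le> \<delta> / 2"
        then have s: "\<delta> / 4 < s / 2" by simp
        have "(\<delta> / 4)\<^sup>2 \<le> (s / 2)\<^sup>2" using s \<delta> by (intro power_mono) auto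
        moreover have "\<delta> / 4 * s \<le> s / 2 * s" using s s0 by (intro mult_right_mono) auto
        moreover have "s\<^sup>2 > 0" using s \<delta> by simp
        ultimately show False using sq by (simp add: power2_eq_square)
      qed
      moreover have "norm (y - x) = 2 * s" using \<theta> by (simp add: y_def s_def)
      ultimately show ?thesis by simp
    qed
    show "\<exists>l y A. norm l \<le> R \<and> norm (y - x) \<le> \<delta> \<and> l \<bullet> y - c k l \<le> J + e0 \<and>
       (\<forall>u. norm u \<le> 1 \<longrightarrow> c k (l + u) \<le> c k l + u \<bullet> y + A * (norm u)\<^sup>2)"
      using nl near cost A(2) unfolding ym by blast
  qed
qed

text \<open>Tilting makes \<open>Y n\<close> stay near \<open>w n *\<^sub>R y\<close> with
  probability at least about \<open>exp (- v n * J)\<close>. Passing to \<open>S n\<close> costs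
  only the probability of the bad event, whose rate \<open>C\<close> is taken above the target
  rate.\<close>

lemma prob_ball_ge:
  assumes J: "\<And>l. l \<bullet> x - \<phi> l \<le> J" and \<delta>: "\<delta> > 0" and e0: "e0 > 0"
  shows "eventually (\<lambda>n. exp (- v n * (J + e0)) \<le> prob {\<omega> \<in> space M. (1 / v n) *\<^sub>R S n \<omega> \<in> ball x \<delta>}) sequentially"
proof -
  have J0: "J \<ge> 0" using J[of 0] by simp
  have "\<delta> / 4 > 0" "e0 / 4 > 0" using \<delta> e0 by auto
  from exposed_point_near[OF J this]
  obtain K1 R where K1: "K1 > r" "R > 0"
    "\<And>k. k \<ge> K1 \<Longrightarrow> \<exists>l y A. norm l \<le> R \<and> norm (y - x) \<le> \<delta> / 4 \<and> l \<bullet> y - c k l \<le> J + e0 / 4 \<and>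
       (\<forall>u. norm u \<le> 1 \<longrightarrow> c k (l + u) \<le> c k l + u \<bullet> y + A * (norm u)\<^sup>2)"
    by blast
  \<comment> \<open>The radius splits into \<open>\<delta> / 8\<close> for \<open>S n\<close>
    against \<open>Y n\<close>, \<open>\<delta> / 8\<close> for the tilted concentration,
    \<open>\<delta> / 8\<close> for \<open>w n / v n\<close> against 1, and
    \<open>\<delta> / 4\<close> for \<open>y\<close> against \<open>x\<close>. The second cap keeps
    \<open>norm l * \<eta>\<close> below \<open>e0 / 4\<close>.\<close>
  define \<eta> where "\<eta> = min (\<delta> / 8) (e0 / (4 * R))"
  have \<eta>: "\<eta> > 0" "\<eta> \<le> \<delta> / 8" "\<eta> \<le> e0 / (4 * R)" using \<delta> e0 K1 by (auto simp: \<eta>_def)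
  define e where "e = \<delta> / 8"
  have e: "e > 0" using \<delta> by (simp add: e_def)
  define C where "C = J + e0 + 1"
  have C: "C > 0" using J0 e0 by (simp add: C_def)
  obtain K2 where K2: "K2 > r" "\<forall>k\<ge>K2. \<exists>Y w. approximant k e C Y w"
    using ex_approximant[OF e C] by blast
  define k where "k = max K1 K2"
  obtain l y A where l: "norm l \<le> R" "norm (y - x) \<le> \<delta> / 4" "l \<bullet> y - c k l \<le> J + e0 / 4"
     "\<And>u. norm u \<le> 1 \<Longrightarrow> c k (l + u) \<le> c k l + u \<bullet> y + A * (norm u)\<^sup>2"
    using K1(3)[of k] by (auto simp: k_def)
  obtain Y w where "approximant k e C Y w" using K2(2)[rule_format, of k] by (auto simp: k_def)
  then have Y: "\<And>n. has_exp_moments (Y n)" "\<And>n l. mgf (Y n) l = exp (w n * c k l)"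
    and w: "eventually (\<lambda>n. 0 < w n \<and> w n \<le> v n) sequentially" "(\<lambda>n. w n / v n) \<longlonglongrightarrow> 1"
    and close: "eventually (\<lambda>n. prob {\<omega> \<in> space M. norm (S n \<omega> - Y n \<omega>) > e * v n} \<le> exp (- C * v n)) sequentially"
    by (auto simp: approximant_def)
  obtain \<kappa> where \<kappa>: "\<kappa> > 0" and tilt: "\<forall>Y a. a > 0 \<longrightarrow> has_exp_moments Y \<longrightarrow> (\<forall>l. mgf Y l = exp (a * c k l)) \<longrightarrow>
    (1 - 2 * real DIM('v) * exp (- \<kappa> * a)) * exp (- a * (l \<bullet> y - c k l + norm l * \<eta>))
      \<le> prob {\<omega> \<in> space M. norm (Y \<omega> - a *\<^sub>R y) \<le> \<eta> * a}"
    using tilted_lower_bound[where c="c k" and l=l and y=y and K=A, OF l(4) \<eta>(1)] by blast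
  have "norm l * \<eta> \<le> R * (e0 / (4 * R))" using l(1) \<eta> K1 by (intro mult_mono) auto
  also have "\<dots> = e0 / 4" using K1 by simp
  finally have cost: "l \<bullet> y - c k l + norm l * \<eta> \<le> J + e0 / 2" using l(3) by simp
  have ew: "eventually (\<lambda>n. 1/2 < w n / v n) sequentially"
    using order_tendstoD(1)[OF w(2), of "1/2"] by simp
  have "(\<lambda>n. (w n / v n) *\<^sub>R y) \<longlonglongrightarrow> 1 *\<^sub>R y" by (intro tendsto_intros w)
  then have ey: "eventually (\<lambda>n. dist ((w n / v n) *\<^sub>R y) y < \<delta> / 8) sequentially"
    using \<delta> by (intro tendstoD) auto
  \<comment> \<open>Since \<open>w n > v n / 2\<close>, the first bound makes the prefactor of the
    tilted estimate at least \<open>1 / 2\<close>; the second makes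
    \<open>exp (- v n * (e0 / 2))\<close> at most \<open>1 / 4\<close>.\<close>
  define T where "T = max (2 * ln (4 * real DIM('v)) / \<kappa>) (2 * ln 4 / e0)"
  show ?thesis
    using ey eventually_ge_at_top[of 1] w(1) close ew eventually_v_ge[of T]
  proof eventually_elim
    case (elim n)
    have n: "n \<ge> 1" using elim by simp
    have v: "v n > 0" using v_pos[OF n] .
    have wn: "w n > 0" "w n \<le> v n" "v n / 2 < w n" using elim v by (auto simp: field_simps)
    have [measurable]: "S n \<in> borel_measurable M" using has_exp_momentsD(1)[OF exp_moments[OF n]] .
    have [measurable]: "Y n \<in> borel_measurable M" using has_exp_momentsD(1)[OF Y(1)] .
    let ?G = "{\<omega> \<in> space M. norm (Y n \<omega> - w n *\<^sub>R y) \<le> \<eta> * w n}"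
    let ?B = "{\<omega> \<in> space M. norm (S n \<omega> - Y n \<omega>) > e * v n}"
    let ?P = "{\<omega> \<in> space M. (1 / v n) *\<^sub>R S n \<omega> \<in> ball x \<delta>}"
    have P: "?P \<in> events" unfolding mem_ball by measurable
    have B: "?B \<in> events" by measurable
    have T: "ln (4 * real DIM('v)) \<le> \<kappa> * w n" "ln 4 \<le> v n * (e0 / 2)"
    proof -
      have "2 * ln (4 * real DIM('v)) / \<kappa> \<le> v n" "2 * ln 4 / e0 \<le> v n" using elim by (auto simp: T_def)
      then have "ln (4 * real DIM('v)) \<le> \<kappa> * (v n / 2)" and 2: "ln 4 \<le> v n * (e0 / 2)"
        using \<kappa> e0 by (auto simp: field_simps)
      moreover have "\<kappa> * (v n / 2) \<le> \<kappa> * w n" using \<kappa> wn by (intro mult_left_mono) auto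
      ultimately show "ln (4 * real DIM('v)) \<le> \<kappa> * w n" by linarith
      show "ln 4 \<le> v n * (e0 / 2)" by (fact 2)
    qed
    have D: "4 * real DIM('v) \<le> exp (\<kappa> * w n)" using T(1) by (subst (asm) ln_le_iff_le_exp) auto
    have half: "1 / 2 \<le> 1 - 2 * real DIM('v) * exp (- \<kappa> * w n)"
      using D by (simp add: exp_minus field_simps)
    have "exp (- v n * (J + e0 / 2)) \<le> exp (- w n * (l \<bullet> y - c k l + norm l * \<eta>))"
    proof -
      have "w n * (l \<bullet> y - c k l + norm l * \<eta>) \<le> w n * (J + e0 / 2)" using cost wn by (intro mult_left_mono) auto
      also have "\<dots> \<le> v n * (J + e0 / 2)" using wn J0 e0 by (intro mult_right_mono) auto
      finally show ?thesis by simp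
    qed
    then have "1 / 2 * exp (- v n * (J + e0 / 2))
      \<le> (1 - 2 * real DIM('v) * exp (- \<kappa> * w n)) * exp (- w n * (l \<bullet> y - c k l + norm l * \<eta>))"
      using half by (intro mult_mono) auto
    also have "\<dots> \<le> prob ?G" using Y by (intro tilt[rule_format] wn(1)) auto
    also have "\<dots> \<le> prob (?P \<union> ?B)"
    proof (rule finite_measure_mono)
      show "?G \<subseteq> ?P \<union> ?B"
      proof
        fix \<omega> assume \<omega>: "\<omega> \<in> ?G"
        show "\<omega> \<in> ?P \<union> ?B"
        proof (cases "\<omega> \<in> ?B")
          case False
          then have 1: "norm (S n \<omega> - Y n \<omega>) \<le> e * v n" using \<omega> by auto
          have 2: "norm (Y n \<omega> - w n *\<^sub>R y) \<le> \<eta> * v n"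
            using \<omega> wn \<eta>(1) by (smt (verit) mem_Collect_eq mult_left_mono)
          have "(1 / v n) *\<^sub>R S n \<omega> - x = (1 / v n) *\<^sub>R (S n \<omega> - Y n \<omega>) + (1 / v n) *\<^sub>R (Y n \<omega> - w n *\<^sub>R y)
            + ((w n / v n) *\<^sub>R y - y) + (y - x)"
            by (simp add: algebra_simps)
          also have "norm \<dots> \<le> norm ((1 / v n) *\<^sub>R (S n \<omega> - Y n \<omega>)) + norm ((1 / v n) *\<^sub>R (Y n \<omega> - w n *\<^sub>R y))
            + norm ((w n / v n) *\<^sub>R y - y) + norm (y - x)"
            by (intro order_trans[OF norm_triangle_ineq] add_mono order_refl)
          also have "norm ((1 / v n) *\<^sub>R (S n \<omega> - Y n \<omega>)) \<le> e" using 1 v by (simp add: pos_divide_le_eq)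
          also have "norm ((1 / v n) *\<^sub>R (Y n \<omega> - w n *\<^sub>R y)) \<le> \<eta>" using 2 v by (simp add: pos_divide_le_eq)
          also have "norm ((w n / v n) *\<^sub>R y - y) \<le> \<delta> / 8" using elim by (simp add: dist_norm)
          also have "norm (y - x) \<le> \<delta> / 4" by (fact l(2))
          finally have "norm ((1 / v n) *\<^sub>R S n \<omega> - x) < \<delta>" using \<eta>(2) \<delta> by (simp add: e_def)
          then show ?thesis using \<omega> by (simp add: dist_norm norm_minus_commute)
        qed simp
      qed
    qed (use P B in blast)
    also have "\<dots> \<le> prob ?P + prob ?B" by (intro measure_Un_le P B)
    also have "prob ?B \<le> exp (- C * v n)" using elim by simp
    finally have main: "1 / 2 * exp (- v n * (J + e0 / 2)) - exp (- C * v n) \<le> prob ?P" by simp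
    \<comment> \<open>With \<open>E = exp (- v n * (J + e0 / 2))\<close> the target is
      \<open>E * q\<close>, which also dominates the bad event. From \<open>q \<le> 1 / 4\<close> it
      follows that \<open>E / 2 - E * q \<ge> E * q\<close>.\<close>
    define q where "q = exp (- v n * (e0 / 2))"
    have q4: "q \<le> 1 / 4"
    proof -
      have "4 \<le> exp (v n * (e0 / 2))" using T(2) by (subst (asm) ln_le_iff_le_exp) auto
      then show ?thesis by (simp add: q_def exp_minus field_simps)
    qed
    have 1: "exp (- v n * (J + e0)) = exp (- v n * (J + e0 / 2)) * q"
      unfolding q_def exp_add[symmetric] by (simp add: algebra_simps)
    have 2: "exp (- C * v n) \<le> exp (- v n * (J + e0))"
      using v by (simp add: C_def algebra_simps)
    have "exp (- v n * (J + e0 / 2)) * q \<le> exp (- v n * (J + e0 / 2)) * (1 / 4)"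
      using q4 by (intro mult_left_mono) auto
    then show ?case using main 1 2 by linarith
  qed
qed

lemma LDP_fenchel: "LDP M (\<lambda>n \<omega>. (1 / v n) *\<^sub>R S n \<omega>) v (fenchel \<phi>)"
  unfolding LDP_def
proof (intro ballI conjI)
  fix \<Gamma> :: "'v set" assume \<Gamma>: "\<Gamma> \<in> sets borel"
  define p where "p n = prob {\<omega> \<in> space M. (1 / v n) *\<^sub>R S n \<omega> \<in> \<Gamma>}" for n
  define f where "f n = ereal (1 / v n) * elog (p n)" for n
  have f_ge: "ereal s \<le> f n" if "n \<ge> 1" "exp (v n * s) \<le> p n" for n s
  proof -
    have p: "p n > 0" using that(2) by (meson exp_gt_zero less_le_trans)
    then have "v n * s \<le> ln (p n)" using that(2) by (simp add: ln_ge_iff)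
    then show ?thesis using p v_pos[OF that(1)] by (simp add: f_def elog_def field_simps)
  qed
  have f_le: "f n \<le> ereal s" if "n \<ge> 1" "p n \<le> exp (v n * s)" for n s
  proof (cases "p n = 0")
    case True
    then show ?thesis using v_pos[OF that(1)] by (simp add: f_def elog_def)
  next
    case False
    then have p: "p n > 0" using measure_nonneg by (simp add: p_def less_le)
    then have "ln (p n) \<le> v n * s" using that(2) by (simp add: ln_le_iff_le_exp)
    then show ?thesis using p v_pos[OF that(1)] by (simp add: f_def elog_def field_simps)
  qed
  have meas: "{\<omega> \<in> space M. (1 / v n) *\<^sub>R S n \<omega> \<in> A} \<in> events" if "n \<ge> 1" "A \<in> sets borel" for n A
  proof -
    have [measurable]: "S n \<in> borel_measurable M" "A \<in> sets borel"
      using has_exp_momentsD(1)[OF exp_moments[OF that(1)]] that(2) by auto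
    show ?thesis by measurable
  qed
  have "- fenchel \<phi> x \<le> liminf f" if x: "x \<in> interior \<Gamma>" for x
  proof (cases "fenchel \<phi> x")
    case (real J)
    have Jx: "l \<bullet> x - \<phi> l \<le> J" for l using fenchel_le_iff[of x J] real by simp
    obtain \<delta> where \<delta>: "\<delta> > 0" "ball x \<delta> \<subseteq> \<Gamma>" using x by (auto simp: mem_interior)
    have "ereal (- J) \<le> liminf f"
    proof (rule ereal_le_epsilon2)
      fix e0 :: real assume e0: "e0 > 0"
      have "eventually (\<lambda>n. ereal (- J - e0) \<le> f n) sequentially"
        using prob_ball_ge[OF Jx \<delta>(1) e0] eventually_ge_at_top[of 1]
      proof eventually_elim
        case (elim n)
        have "prob {\<omega> \<in> space M. (1 / v n) *\<^sub>R S n \<omega> \<in> ball x \<delta>} \<le> p n"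
          unfolding p_def using \<delta>(2) meas[OF elim(2) \<Gamma>] by (intro finite_measure_mono) auto
        then show ?case using elim by (intro f_ge) (auto simp: algebra_simps)
      qed
      then have "ereal (- J - e0) \<le> liminf f" by (rule Liminf_bounded)
      then have "ereal (- J - e0) + ereal e0 \<le> liminf f + ereal e0" by (rule add_right_mono)
      then show "ereal (- J) \<le> liminf f + ereal e0" by simp
    qed
    then show ?thesis using real by simp
  next
    case MInf
    then show ?thesis using fenchel_nonneg[of x] by simp
  qed simp
  then have "- liminf f \<le> (INF x\<in>interior \<Gamma>. fenchel \<phi> x)"
    by (intro INF_greatest) (simp add: ereal_uminus_le_reorder)
  then show "- (INF x\<in>interior \<Gamma>. fenchel \<phi> x)
     \<le> liminf (\<lambda>n. ereal (1 / v n) * elog (prob {\<omega> \<in> space M. (1 / v n) *\<^sub>R S n \<omega> \<in> \<Gamma>}))"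
    unfolding f_def p_def by (simp add: ereal_uminus_le_reorder)
  have "(INF x\<in>closure \<Gamma>. fenchel \<phi> x) \<le> - limsup f"
  \<comment> \<open>The infimum may be infinite, so the bound is proved for each real number
    strictly below it.\<close>
  proof (rule dense_le)
    fix z assume z: "z < (INF x\<in>closure \<Gamma>. fenchel \<phi> x)"
    show "z \<le> - limsup f"
    proof (cases z)
      case (real \<alpha>)
      have \<alpha>: "ereal \<alpha> < fenchel \<phi> x" if "x \<in> closure \<Gamma>" for x
        using z real that by (metis INF_lower less_le_trans)
      have "limsup f \<le> ereal (- \<alpha>)"
      proof (rule ereal_le_epsilon2)
        fix e0 :: real assume e0: "e0 > 0"
        have "eventually (\<lambda>n. f n \<le> ereal (e0 - \<alpha>)) sequentially"
          using prob_closed_le[of "closure \<Gamma>" \<alpha> e0, OF closed_closure \<alpha> e0, simplified] eventually_ge_at_top[of 1]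
        proof eventually_elim
          case (elim n)
          have "p n \<le> prob {\<omega> \<in> space M. (1 / v n) *\<^sub>R S n \<omega> \<in> closure \<Gamma>}"
            unfolding p_def using closure_subset meas[OF elim(2), of "closure \<Gamma>"]
            by (intro finite_measure_mono) auto
          then show ?case using elim by (intro f_le) auto
        qed
        then have "limsup f \<le> ereal (e0 - \<alpha>)" by (rule Limsup_bounded)
        then show "limsup f \<le> ereal (- \<alpha>) + ereal e0" by simp
      qed
      then show ?thesis using real ereal_minus_le_minus[of "ereal (- \<alpha>)" "limsup f"] by simp
    qed (use z in auto)
  qed
  then have "limsup f \<le> - (INF x\<in>closure \<Gamma>. fenchel \<phi> x)"
    using ereal_minus_le_minus[of "- limsup f" "INF x\<in>closure \<Gamma>. fenchel \<phi> x"] by simp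
  then show "limsup (\<lambda>n. ereal (1 / v n) * elog (prob {\<omega> \<in> space M. (1 / v n) *\<^sub>R S n \<omega> \<in> \<Gamma>}))
     \<le> - (INF x\<in>closure \<Gamma>. fenchel \<phi> x)"
    unfolding f_def p_def .
qed

end

section \<open>Block sums of independent copies\<close>

lemma cube_eq_lists: "cube d m = {z. set z \<subseteq> {- int m..int m} \<and> length z = d}"
  unfolding cube_def by (auto simp: subset_iff in_set_conv_nth)

lemma finite_cube: "finite (cube d m)"
  unfolding cube_eq_lists by (rule finite_lists_length_eq) simp

lemma card_cube: "card (cube d m) = (2 * m + 1) ^ d"
  unfolding cube_eq_lists by (subst card_lists_length_eq) (simp_all add: nat_add_distrib nat_mult_distrib flip: int_Suc)

lemma mblock_bounds:
  assumes "k \<ge> 1" "k \<le> n"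
  shows "(2 * mblock k n + 1) * k \<le> n" "n < (2 * mblock k n + 3) * k"
proof -
  let ?P = "\<lambda>m. (2 * m + 1) * k \<le> n \<and> n < (2 * m + 3) * k"
  \<comment> \<open>For \<open>q = n div k\<close> this is the largest \<open>m\<close> with
    \<open>2 * m + 1 \<le> q\<close>.\<close>
  have ex: "?P ((n div k - 1) div 2)"
  proof -
    define q where "q = n div k"
    have q: "q \<ge> 1" using assms by (simp add: q_def Suc_le_eq div_greater_zero_iff)
    have n: "q * k \<le> n" "n < (q + 1) * k"
      using assms dividend_less_div_times[of k n] by (simp_all add: q_def)
    have "2 * ((q - 1) div 2) + 1 \<le> q" "q + 1 \<le> 2 * ((q - 1) div 2) + 3" using q by presburger+
    then have "(2 * ((q - 1) div 2) + 1) * k \<le> q * k" "(q + 1) * k \<le> (2 * ((q - 1) div 2) + 3) * k"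
      by (meson mult_le_mono1)+
    with n show ?thesis unfolding q_def by linarith
  qed
  have not_lt: "\<not> m < m'" if "?P m" "?P m'" for m m'
  proof
    assume "m < m'"
    then have "(2 * m + 3) * k \<le> (2 * m' + 1) * k" by (intro mult_le_mono1) simp
    with that show False by linarith
  qed
  have "?P (mblock k n)" unfolding mblock_def
  proof (rule theI[of ?P, OF ex])
    show "m = (n div k - 1) div 2" if "?P m" for m
      using not_lt[OF that ex] not_lt[OF ex that] by linarith
  qed
  then show "(2 * mblock k n + 1) * k \<le> n" "n < (2 * mblock k n + 3) * k" by auto
qed

lemma boxvol_mult: "boxvol d (m * k) = real m ^ d * boxvol d k"
  by (simp add: boxvol_def power_mult_distrib mult_ac)

lemma boxvol_mono: "mono (boxvol d)"
  by (intro monoI) (simp add: boxvol_def power_mono)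

lemma boxvol_ge_1: "n \<ge> 1 \<Longrightarrow> boxvol d n \<ge> 1"
  unfolding boxvol_def by (rule one_le_power) simp

lemma boxvol_at_top:
  assumes "d \<ge> 1"
  shows "filterlim (boxvol d) at_top sequentially"
proof (rule filterlim_at_top_mono[OF filterlim_real_sequentially])
  show "eventually (\<lambda>n. real n \<le> boxvol d n) sequentially"
    using eventually_ge_at_top[of 1]
  proof eventually_elim
    case (elim n)
    have "real n \<le> 2 * real n" by simp
    also have "\<dots> \<le> (2 * real n) ^ d" using elim assms by (intro self_le_power) auto
    finally show ?case by (simp add: boxvol_def)
  qed
qed

lemma boxvol_shift_tendsto: "(\<lambda>n. boxvol d (n + r) / boxvol d n) \<longlonglongrightarrow> 1"
proof -
  have "(\<lambda>n. (1 + real r / real n) ^ d) \<longlonglongrightarrow> (1 + 0) ^ d"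
    by (intro tendsto_intros lim_const_over_n)
  moreover have "eventually (\<lambda>n. (1 + real r / real n) ^ d = boxvol d (n + r) / boxvol d n) sequentially"
    using eventually_ge_at_top[of 1]
  proof eventually_elim
    case (elim n)
    then have "1 + real r / real n = (2 * real (n + r)) / (2 * real n)" by (simp add: field_simps)
    then show ?case unfolding boxvol_def by (simp only: power_divide)
  qed
  ultimately show ?thesis by (simp add: tendsto_cong)
qed

text \<open>Rounding down to an odd multiple of \<open>k\<close> loses less than
  \<open>2 * k\<close>, which is negligible against \<open>n\<close>.\<close>

lemma boxvol_block_tendsto:
  assumes k: "k \<ge> 1"
  shows "(\<lambda>n. boxvol d ((2 * mblock k n + 1) * k) / boxvol d n) \<longlonglongrightarrow> 1"
proof -
  let ?a = "\<lambda>n. (2 * mblock k n + 1) * k"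
  have "(\<lambda>n. real (?a n) / real n) \<longlonglongrightarrow> 1"
  proof (rule tendsto_sandwich)
    have "(\<lambda>n. 1 - real (2 * k) / real n) \<longlonglongrightarrow> 1 - 0"
      by (intro tendsto_intros lim_const_over_n)
    then show "(\<lambda>n. 1 - real (2 * k) / real n) \<longlonglongrightarrow> 1" by simp
    show "eventually (\<lambda>n. 1 - real (2 * k) / real n \<le> real (?a n) / real n) sequentially"
      using eventually_ge_at_top[of k]
    proof eventually_elim
      case (elim n)
      have "n \<le> ?a n + 2 * k" using mblock_bounds(2)[OF k elim] by (simp add: algebra_simps)
      then have "real n - real (2 * k) \<le> real (?a n)" by linarith
      then have "(real n - real (2 * k)) / real n \<le> real (?a n) / real n" by (rule divide_right_mono) simp
      then show ?case using elim k by (simp add: diff_divide_distrib)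
    qed
    show "eventually (\<lambda>n. real (?a n) / real n \<le> 1) sequentially"
      using eventually_ge_at_top[of k]
    proof eventually_elim
      case (elim n)
      have "real (?a n) \<le> real n" using mblock_bounds(1)[OF k elim] by (simp only: of_nat_le_iff)
      then show ?case using elim k by (simp add: divide_le_eq_1)
    qed
  qed simp
  then have "(\<lambda>n. (real (?a n) / real n) ^ d) \<longlonglongrightarrow> 1 ^ d" by (intro tendsto_power)
  moreover have "(real a / real n) ^ d = boxvol d a / boxvol d n" for a n
    by (simp add: boxvol_def power_divide power_mult_distrib)
  ultimately show ?thesis by (simp only: power_one)
qed

section \<open>From the hypotheses on the process to the abstract approximation\<close>

lemma (in prob_space) mgf_sum_iid:
  fixes X :: "'a \<Rightarrow> 'v::euclidean_space"
  assumes X: "has_exp_moments X" and I: "finite I"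
    and meas: "\<And>i. i \<in> I \<Longrightarrow> Z i \<in> borel_measurable M"
    and indep: "indep_vars (\<lambda>_. borel) Z I"
    and distr: "\<And>i. i \<in> I \<Longrightarrow> distr M borel (Z i) = distr M borel X"
  shows "has_exp_moments (\<lambda>\<omega>. \<Sum>i\<in>I. Z i \<omega>)" "mgf (\<lambda>\<omega>. \<Sum>i\<in>I. Z i \<omega>) l = mgf X l ^ card I"
proof -
  have Xm: "X \<in> borel_measurable M" using has_exp_momentsD(1)[OF X] .
  have eq: "exp (l \<bullet> (\<Sum>i\<in>I. Z i \<omega>)) = (\<Prod>i\<in>I. exp (l \<bullet> Z i \<omega>))" for l \<omega>
    using I by (simp add: inner_sum_right exp_sum)
  have ind: "indep_vars (\<lambda>_. borel) (\<lambda>i \<omega>. exp (l \<bullet> Z i \<omega>)) I" for l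
    using indep_vars_compose2[OF indep, of "\<lambda>_ x. exp (l \<bullet> x)" "\<lambda>_. borel"] by simp
  have int: "integrable M (\<lambda>\<omega>. exp (l \<bullet> Z i \<omega>))" if "i \<in> I" for i l
    using integrable_distr_eq[OF meas[OF that], of "\<lambda>x. exp (l \<bullet> x)"]
      integrable_distr_eq[OF Xm, of "\<lambda>x. exp (l \<bullet> x)"] distr[OF that] has_exp_momentsD(2)[OF X] by simp
  have expZ: "expectation (\<lambda>\<omega>. exp (l \<bullet> Z i \<omega>)) = mgf X l" if "i \<in> I" for i l
    using integral_distr[OF meas[OF that], of "\<lambda>x. exp (l \<bullet> x)"]
      integral_distr[OF Xm, of "\<lambda>x. exp (l \<bullet> x)"] distr[OF that] by (simp add: mgf_def)
  have "(\<lambda>\<omega>. \<Sum>i\<in>I. Z i \<omega>) \<in> borel_measurable M" using meas by (rule borel_measurable_sum)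
  then show "has_exp_moments (\<lambda>\<omega>. \<Sum>i\<in>I. Z i \<omega>)"
    unfolding has_exp_moments_def eq using indep_vars_integrable[OF I ind int] by blast
  show "mgf (\<lambda>\<omega>. \<Sum>i\<in>I. Z i \<omega>) l = mgf X l ^ card I"
    unfolding mgf_def[of "\<lambda>\<omega>. \<Sum>i\<in>I. Z i \<omega>"] eq
    by (subst indep_vars_lebesgue_integral[OF I ind int]) (simp_all add: expZ)
qed

lemma (in prob_space) has_exp_moments_of_nn_integral_le:
  fixes X :: "'a \<Rightarrow> 'v::euclidean_space"
  assumes X: "X \<in> borel_measurable M"
    and le: "\<And>l. (\<integral>\<^sup>+ \<omega>. ennreal (exp (l \<bullet> X \<omega>)) \<partial>M) \<le> ennreal (b l)"
  shows "has_exp_moments X" "b l \<ge> 0 \<Longrightarrow> mgf X l \<le> b l"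
proof -
  have int: "integrable M (\<lambda>\<omega>. exp (l \<bullet> X \<omega>))" for l
  proof (rule integrableI_bounded)
    show "(\<lambda>\<omega>. exp (l \<bullet> X \<omega>)) \<in> borel_measurable M" using X by measurable
    have "(\<integral>\<^sup>+ \<omega>. ennreal (norm (exp (l \<bullet> X \<omega>))) \<partial>M) \<le> ennreal (b l)" using le[of l] by simp
    also have "\<dots> < \<infinity>" by simp
    finally show "(\<integral>\<^sup>+ \<omega>. ennreal (norm (exp (l \<bullet> X \<omega>))) \<partial>M) < \<infinity>" .
  qed
  then show "has_exp_moments X" using X by (simp add: has_exp_moments_def)
  assume b: "b l \<ge> 0"
  have "ennreal (mgf X l) = (\<integral>\<^sup>+ \<omega>. ennreal (exp (l \<bullet> X \<omega>)) \<partial>M)"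
    unfolding mgf_def by (rule nn_integral_eq_integral[symmetric, OF int]) simp
  then show "mgf X l \<le> b l" using le[of l] b by (metis ennreal_le_iff)
qed

lemma (in prob_space) exp_norm_bound_of_mgf_bound:
  fixes S :: "nat \<Rightarrow> 'a \<Rightarrow> 'v::euclidean_space"
  assumes X: "\<And>n. n \<ge> 1 \<Longrightarrow> has_exp_moments (S n)"
    and v: "\<And>n. n \<ge> 1 \<Longrightarrow> v n \<ge> 1"
    and B: "\<And>n l. n \<ge> 1 \<Longrightarrow> mgf (S n) l \<le> exp (B l * v n)"
    and t: "t \<ge> 0"
  shows "\<exists>B. \<forall>n\<ge>1. expectation (\<lambda>\<omega>. exp (t * norm (S n \<omega>))) \<le> exp (B * v n)"
proof -
  let ?p = "\<lambda>b. (t * real DIM('v)) *\<^sub>R b" and ?m = "\<lambda>b. (- (t * real DIM('v))) *\<^sub>R b"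
  \<comment> \<open>A common rate for all signed coordinate directions. The number
    \<open>2 * DIM('v)\<close> of terms is turned into a further rate by its logarithm, using
    \<open>v n \<ge> 1\<close>.\<close>
  define A where "A = (\<Sum>b\<in>(Basis::'v set). \<bar>B (?p b)\<bar> + \<bar>B (?m b)\<bar>)"
  have A: "B (?p b) \<le> A" "B (?m b) \<le> A" if "b \<in> Basis" for b
  proof -
    have "\<bar>B (?p b)\<bar> + \<bar>B (?m b)\<bar> \<le> A" unfolding A_def
      using that by (intro member_le_sum) (auto intro: add_nonneg_nonneg)
    then show "B (?p b) \<le> A" "B (?m b) \<le> A" by linarith+
  qed
  have "expectation (\<lambda>\<omega>. exp (t * norm (S n \<omega>))) \<le> exp ((A + ln (2 * real DIM('v))) * v n)" if n: "n \<ge> 1" for n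
  proof -
    have le: "mgf (S n) l \<le> exp (A * v n)" if "B l \<le> A" for l
    proof -
      have "B l * v n \<le> A * v n" using that v[OF n] by (intro mult_right_mono) auto
      then show ?thesis using B[OF n, of l] by (meson exp_le_cancel_iff order_trans)
    qed
    have "expectation (\<lambda>\<omega>. exp (t * norm (S n \<omega>))) \<le> (\<Sum>b\<in>(Basis::'v set). mgf (S n) (?p b) + mgf (S n) (?m b))"
      by (rule expectation_exp_norm_le[OF X[OF n] t])
    also have "\<dots> \<le> (\<Sum>b\<in>(Basis::'v set). exp (A * v n) + exp (A * v n))"
      using A by (intro sum_mono add_mono le) auto
    also have "\<dots> = 2 * real DIM('v) * exp (A * v n)" by simp
    also have "\<dots> = exp (ln (2 * real DIM('v)) * 1) * exp (A * v n)" by simp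
    also have "\<dots> \<le> exp (ln (2 * real DIM('v)) * v n) * exp (A * v n)"
    proof -
      have "1 \<le> 2 * real DIM('v)" using DIM_positive[where 'a='v] by linarith
      then have "0 \<le> ln (2 * real DIM('v))" by (rule ln_ge_zero)
      then have "ln (2 * real DIM('v)) * 1 \<le> ln (2 * real DIM('v)) * v n" using v[OF n] by (intro mult_left_mono) auto
      then show ?thesis by (intro mult_right_mono) (simp_all only: exp_le_cancel_iff exp_ge_zero)
    qed
    also have "\<dots> = exp ((A + ln (2 * real DIM('v))) * v n)"
      unfolding exp_add[symmetric] by (simp add: algebra_simps)
    finally show ?thesis .
  qed
  then show ?thesis by blast
qed

text \<open>Regularity compares \<open>S n\<close> with \<open>S\<close> at the nearest odd multiple
  of \<open>k\<close> from below, near additivity compares that with the block sum; each takes half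
  of \<open>e\<close>.\<close>

lemma (in prob_space) mgf_approx_of_nearly_additive:
  fixes S :: "nat \<Rightarrow> 'a \<Rightarrow> 'v::euclidean_space"
  assumes d: "d \<ge> 1"
    and X: "\<And>n. n \<ge> 1 \<Longrightarrow> has_exp_moments (S n)"
    and B: "\<And>n l. n \<ge> 1 \<Longrightarrow> mgf (S n) l \<le> exp (B l * boxvol d n)"
    and reg: "exp_regular M d S" and add: "exp_r_nearly_additive M d S r"
  shows "mgf_approx M S (boxvol d) r"
proof -
  obtain S' :: "nat \<Rightarrow> int list \<Rightarrow> 'a \<Rightarrow> 'v" where
    iid: "\<forall>n\<ge>1. (\<forall>z. S' n z \<in> borel_measurable M)
        \<and> indep_vars (\<lambda>_. borel) (S' n) {z. length z = d}
        \<and> (\<forall>z. length z = d \<longrightarrow> distr M borel (S' n z) = distr M borel (S n))"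
    and close: "\<forall>e>0. \<forall>C>0. \<exists>K::nat. K > r \<and> (\<forall>k\<ge>K. \<forall>m\<ge>1.
           prob {\<omega> \<in> space M.
              norm (S ((2*m+1)*k) \<omega> - (\<Sum>z\<in>cube d m. S' (k - r) z \<omega>))
                > e * boxvol d ((2*m+1)*k)}
           \<le> exp (- C * boxvol d ((2*m+1)*k)))"
    using add unfolding exp_r_nearly_additive_def by (elim exE conjE) (rule that)
  have S': "S' n z \<in> borel_measurable M"
      "indep_vars (\<lambda>_. borel) (S' n) {z. length z = d}"
      "length z = d \<Longrightarrow> distr M borel (S' n z) = distr M borel (S n)" if "n \<ge> 1" for n z
    using iid that by auto
  show ?thesis
  proof unfold_locales
    show "\<exists>B. \<forall>n\<ge>1. expectation (\<lambda>\<omega>. exp (t * norm (S n \<omega>))) \<le> exp (B * boxvol d n)" if "t \<ge> 0" for t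
      using exp_norm_bound_of_mgf_bound[OF X boxvol_ge_1 B that] .
    fix e C :: real assume e: "e > 0" and C: "C > 0"
    \<comment> \<open>Of the rate \<open>4 * C\<close> one half is lost through
      \<open>w n > v n / 2\<close>. Of the remaining \<open>2 * C\<close>, one \<open>C\<close>
      absorbs the factor 2 from the union of two events.\<close>
    have e2: "e / 2 > 0" and C4: "4 * C > 0" using e C by auto
    obtain K where K: "K > r" "\<And>k m. k \<ge> K \<Longrightarrow> m \<ge> 1 \<Longrightarrow>
           prob {\<omega> \<in> space M.
              norm (S ((2*m+1)*k) \<omega> - (\<Sum>z\<in>cube d m. S' (k - r) z \<omega>))
                > e / 2 * boxvol d ((2*m+1)*k)}
           \<le> exp (- (4 * C) * boxvol d ((2*m+1)*k))"
      using close[rule_format, OF e2 C4] by blast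
    show "\<exists>K>r. \<forall>k\<ge>K. \<exists>Y w.
        (\<forall>n. has_exp_moments (Y n)) \<and>
        (\<forall>n l. mgf (Y n) l = exp (w n * (ln (mgf (S (k - r)) l) / boxvol d k))) \<and>
        eventually (\<lambda>n. 0 < w n \<and> w n \<le> boxvol d n) sequentially \<and>
        (\<lambda>n. w n / boxvol d n) \<longlonglongrightarrow> 1 \<and>
        eventually (\<lambda>n. prob {\<omega> \<in> space M. norm (S n \<omega> - Y n \<omega>) > e * boxvol d n} \<le> exp (- C * boxvol d n)) sequentially"
    proof (intro exI[of _ K] conjI K(1) allI impI)
      fix k assume k: "k \<ge> K"
      have k1: "k \<ge> 1" and kr: "k - r \<ge> 1" using k K by auto
      let ?v = "boxvol d"
      let ?a = "\<lambda>n. (2 * mblock k n + 1) * k"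
      define Y where "Y n \<omega> = (\<Sum>z\<in>cube d (mblock k n). S' (k - r) z \<omega>)" for n \<omega>
      define w where "w n = ?v (?a n)" for n
      have sub: "cube d m \<subseteq> {z. length z = d}" for m by (auto simp: cube_def)
      have iid: "has_exp_moments (Y n)" "mgf (Y n) l = mgf (S (k - r)) l ^ card (cube d (mblock k n))" for n l
        unfolding Y_def using sub
        by (auto intro!: mgf_sum_iid[OF X[OF kr] finite_cube S'(1)[OF kr]
            indep_vars_subset[OF S'(2)[OF kr] sub] S'(3)[OF kr]])
      have mgfY: "mgf (Y n) l = exp (w n * (ln (mgf (S (k - r)) l) / ?v k))" for n l
      proof -
        \<comment> \<open>The volume ratio \<open>w n / ?v k\<close> is
          \<open>(2 * mblock k n + 1) ^ d\<close>, the number of summands, so the identity is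
          exact.\<close>
        have "w n * (ln (mgf (S (k - r)) l) / ?v k) = real (card (cube d (mblock k n))) * ln (mgf (S (k - r)) l)"
          using boxvol_ge_1[OF k1, of d] unfolding w_def boxvol_mult card_cube by simp
        then show ?thesis
          unfolding iid(2) using mgf_pos[OF X[OF kr], of l] by (simp add: exp_of_nat_mult)
      qed
      have wlim: "(\<lambda>n. w n / ?v n) \<longlonglongrightarrow> 1" unfolding w_def by (rule boxvol_block_tendsto[OF k1])
      have wb: "0 < w n" "w n \<le> ?v n" if "n \<ge> k" for n
      proof -
        show "0 < w n" using boxvol_ge_1[of "?a n" d] k1 unfolding w_def by (simp add: less_le_trans[OF zero_less_one])
        show "w n \<le> ?v n" unfolding w_def using mblock_bounds(1)[OF k1 that] boxvol_mono by (rule monoD[rotated])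
      qed
      obtain N where N: "\<And>n. n \<ge> N \<Longrightarrow> k \<le> n \<Longrightarrow>
        prob {\<omega> \<in> space M. norm (S n \<omega> - S (?a n) \<omega>) > e / 2 * ?v n} \<le> exp (- (4 * C) * ?v n)"
        using reg[unfolded exp_regular_def, rule_format, OF k1 e2 C4] by blast
      have ew: "eventually (\<lambda>n. 1/2 < w n / ?v n) sequentially"
        using order_tendstoD(1)[OF wlim, of "1/2"] by simp
      have ev: "eventually (\<lambda>n. ?v n \<ge> ln 2 / C) sequentially"
        using boxvol_at_top[OF d] by (simp add: filterlim_at_top)
      have "eventually (\<lambda>n. prob {\<omega> \<in> space M. norm (S n \<omega> - Y n \<omega>) > e * ?v n} \<le> exp (- C * ?v n)) sequentially"
        \<comment> \<open>From \<open>3 * k\<close> on the block index is at least 1, as near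
          additivity requires.\<close>
        using ew ev eventually_ge_at_top[of N] eventually_ge_at_top[of "3 * k"]
      proof eventually_elim
        case (elim n)
        have nk: "n \<ge> k" and n1: "n \<ge> 1" using elim k1 by auto
        have v: "?v n > 0" using boxvol_ge_1[OF n1, of d] by simp
        have m1: "mblock k n \<ge> 1"
        proof (rule ccontr)
          assume "\<not> mblock k n \<ge> 1"
          then have "mblock k n = 0" by simp
          then show False using mblock_bounds(2)[OF k1 nk] elim by simp
        qed
        have a1: "?a n \<ge> 1" using k1 by simp
        have [measurable]: "S n \<in> borel_measurable M" "S (?a n) \<in> borel_measurable M" "Y n \<in> borel_measurable M"
          using has_exp_momentsD(1) X[OF n1] X[OF a1] iid(1) by blast+
        let ?A = "{\<omega> \<in> space M. norm (S n \<omega> - S (?a n) \<omega>) > e / 2 * ?v n}"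
        let ?B = "{\<omega> \<in> space M. norm (S (?a n) \<omega> - Y n \<omega>) > e / 2 * w n}"
        have "prob {\<omega> \<in> space M. norm (S n \<omega> - Y n \<omega>) > e * ?v n} \<le> prob (?A \<union> ?B)"
        proof (rule finite_measure_mono)
          show "{\<omega> \<in> space M. norm (S n \<omega> - Y n \<omega>) > e * ?v n} \<subseteq> ?A \<union> ?B"
          proof (rule subsetI, rule ccontr)
            fix \<omega> assume "\<omega> \<in> {\<omega> \<in> space M. norm (S n \<omega> - Y n \<omega>) > e * ?v n}" "\<omega> \<notin> ?A \<union> ?B"
            then have "norm (S n \<omega> - Y n \<omega>) > e * ?v n"
              "norm (S n \<omega> - S (?a n) \<omega>) \<le> e / 2 * ?v n" "norm (S (?a n) \<omega> - Y n \<omega>) \<le> e / 2 * w n"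
              by (simp_all only: mem_Collect_eq Un_iff) (simp_all only: not_less simp_thms de_Morgan_disj)
            moreover have "e / 2 * w n \<le> e / 2 * ?v n" using wb(2)[OF nk] e by (intro mult_left_mono) auto
            moreover have "norm (S n \<omega> - Y n \<omega>) \<le> norm (S n \<omega> - S (?a n) \<omega>) + norm (S (?a n) \<omega> - Y n \<omega>)"
              by (rule dist_triangle[of "S n \<omega>" "Y n \<omega>" "S (?a n) \<omega>", unfolded dist_norm])
            ultimately show False by linarith
          qed
        qed measurable
        also have "\<dots> \<le> prob ?A + prob ?B" by (intro measure_Un_le) measurable
        also have "\<dots> \<le> exp (- (4 * C) * ?v n) + exp (- (4 * C) * w n)"
          using N[OF elim(3) nk] K(2)[OF k m1] unfolding Y_def w_def by (intro add_mono)
        also have "\<dots> \<le> exp (- C * ?v n - C * ?v n) + exp (- C * ?v n - C * ?v n)"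
        proof (intro add_mono)
          have "C * ?v n > 0" using C v by simp
          then show "exp (- (4 * C) * ?v n) \<le> exp (- C * ?v n - C * ?v n)" by simp
          have "C * (?v n / 2) \<le> C * w n" using elim v C by (intro mult_left_mono) (auto simp: field_simps)
          then show "exp (- (4 * C) * w n) \<le> exp (- C * ?v n - C * ?v n)" by simp
        qed
        also have "\<dots> = 2 * exp (- C * ?v n) * exp (- C * ?v n)" unfolding diff_conv_add_uminus exp_add by simp
        also have "\<dots> \<le> 1 * exp (- C * ?v n)"
        proof (intro mult_right_mono)
          have "ln 2 \<le> C * ?v n" using elim C by (simp add: field_simps)
          then have "2 \<le> exp (C * ?v n)" by (subst (asm) ln_le_iff_le_exp) auto
          then show "2 * exp (- C * ?v n) \<le> 1" by (simp add: exp_minus field_simps)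
        qed simp
        finally show ?case by simp
      qed
      moreover have "eventually (\<lambda>n. 0 < w n \<and> w n \<le> ?v n) sequentially"
        using eventually_ge_at_top[of k] by eventually_elim (use wb in blast)
      ultimately show "\<exists>Y w.
        (\<forall>n. has_exp_moments (Y n)) \<and>
        (\<forall>n l. mgf (Y n) l = exp (w n * (ln (mgf (S (k - r)) l) / boxvol d k))) \<and>
        eventually (\<lambda>n. 0 < w n \<and> w n \<le> boxvol d n) sequentially \<and>
        (\<lambda>n. w n / boxvol d n) \<longlonglongrightarrow> 1 \<and>
        eventually (\<lambda>n. prob {\<omega> \<in> space M. norm (S n \<omega> - Y n \<omega>) > e * boxvol d n} \<le> exp (- C * boxvol d n)) sequentially"
        using iid(1) mgfY wlim by blast
    qed
  qed (use X boxvol_ge_1 boxvol_at_top[OF d] boxvol_mono boxvol_shift_tendsto in auto)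
qed

theorem mainTheorem5:
  fixes M :: "'a measure" and d :: nat and S :: "nat \<Rightarrow> 'a \<Rightarrow> 'v::euclidean_space"
  assumes "prob_space M"
    and "d \<ge> 1"
    and "\<And>n. n \<ge> 1 \<Longrightarrow> S n \<in> borel_measurable M"
    and "exp_regular M d S"
    and "exp_nearly_additive M d S"
    and "\<And>l. \<exists>B::real. \<forall>n\<ge>1.
           (\<integral>\<^sup>+ \<omega>. ennreal (exp (l \<bullet> S n \<omega>)) \<partial>M) \<le> ennreal (exp (B * boxvol d n))"
  shows "\<exists>Shat::'v. \<exists>\<phi>::'v \<Rightarrow> real.
           ((\<lambda>n. (1 / boxvol d n) *\<^sub>R (\<integral>\<omega>. S n \<omega> \<partial>M)) \<longlonglongrightarrow> Shat)
         \<and> (\<forall>l. (\<lambda>n. ln (\<integral>\<omega>. exp (l \<bullet> S n \<omega>) \<partial>M) / boxvol d n) \<longlonglongrightarrow> \<phi> l)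
         \<and> good_rate_function (fenchel \<phi>)
         \<and> convex_efun (fenchel \<phi>)
         \<and> LDP M (\<lambda>n \<omega>. (1 / boxvol d n) *\<^sub>R S n \<omega>) (boxvol d) (fenchel \<phi>)
         \<and> (\<forall>x. fenchel \<phi> x = 0 \<longleftrightarrow> x = Shat)"
proof -
  interpret prob_space M by fact
  obtain B :: "'v \<Rightarrow> real" where B: "\<And>l n. n \<ge> 1 \<Longrightarrow>
      (\<integral>\<^sup>+ \<omega>. ennreal (exp (l \<bullet> S n \<omega>)) \<partial>M) \<le> ennreal (exp (B l * boxvol d n))"
    using assms(6) by metis
  obtain r where "exp_r_nearly_additive M d S r"
    using assms(5) by (auto simp: exp_nearly_additive_def)
  then interpret mgf_approx M S "boxvol d" r
    using has_exp_moments_of_nn_integral_le[OF assms(3) B] assms(2,4)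
    by (intro mgf_approx_of_nearly_additive[where B=B]) auto
  show ?thesis
    using mean_tendsto scaled_log_mgf_tendsto[unfolded scaled_log_mgf_def mgf_def]
      good_rate_function_fenchel convex_efun_fenchel LDP_fenchel fenchel_eq_0_iff by blast
qed

end
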